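(* Let $G$ and $H$ be two non-trivial groups. Let $C$ be a left-relatively convex proper subgroup of the free product $G*H$. If $C$ is finitely generated, then $\mathcal{PO}_C(G*H)$ has no isolated elements.
   Context: A left-preorder on a group $\Gamma$ is a total, transitive, reflexive binary relation $\preceq$ on $\Gamma$ that is left-invariant ($g_1\preceq g_2$ implies $gg_1\preceq gg_2$) and non-trivial (not all pairs are related). For a left-preorder $\preceq$, the set $C=\{g: g\preceq 1 \text{ and } 1\preceq g\}$ is a proper subgroup of $\Gamma$, and $\preceq$ is said to be a left-preorder on $\Gamma$ relative to $C$; the positive cone is $P=\{g\in\Gamma: 1\preceq g,\ g\notin C\}$, and $\Gamma=P\sqcup P^{-1}\sqcup C$. A proper subgroup $C$ of $\Gamma$ is left-relatively convex on $\Gamma$ if there exists a left-preorder on $\Gamma$ relative to $C$. Each left-preorder is identified with the map $\phi_\preceq:\Gamma\to\{\pm1,0\}$ equal to $1$ on $P$, $-1$ on $P^{-1}$ and $0$ on $C$. $\mathcal{PO}_C(\Gamma)$ is the set of left-preorders on $\Gamma$ relative to $C$, endowed with the subspace topology from $\{\pm1,0\}^\Gamma$, where $\{\pm1,0\}$ is discrete and $\{\pm1,0\}^\Gamma$ has the product topology. *)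

theory Defs
  imports "HOL-Analysis.Function_Topology" "HOL-Algebra.Generated_Groups"
begin

section \<open>Free products\<close>

text \<open>The free product is realised by normal forms: an element is an alternating word in the
  non-trivial elements of the two factors (tagged \<open>Inl\<close>, \<open>Inr\<close>), and the product of two words is
  their concatenation followed by reduction at the junction.\<close>

definition free_product_letters ::
    "('a, 'm) monoid_scheme \<Rightarrow> ('b, 'n) monoid_scheme \<Rightarrow> ('a + 'b) set" where
  "free_product_letters G H =
     Inl ` (carrier G - {\<one>\<^bsub>G\<^esub>}) \<union> Inr ` (carrier H - {\<one>\<^bsub>H\<^esub>})"

definition reduced_words ::
    "('a, 'm) monoid_scheme \<Rightarrow> ('b, 'n) monoid_scheme \<Rightarrow> ('a + 'b) list set" where
  "reduced_words G H =
     {w. set w \<subseteq> free_product_letters G H \<and> successively (\<lambda>x y. isl x \<noteq> isl y) w}"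

text \<open>Left multiplication of a reduced word by a single letter.\<close>

fun letter_mult ::
    "('a, 'm) monoid_scheme \<Rightarrow> ('b, 'n) monoid_scheme \<Rightarrow> 'a + 'b \<Rightarrow> ('a + 'b) list \<Rightarrow> ('a + 'b) list"
  where
  "letter_mult G H (Inl g) (Inl g' # w) =
     (if g \<otimes>\<^bsub>G\<^esub> g' = \<one>\<^bsub>G\<^esub> then w else Inl (g \<otimes>\<^bsub>G\<^esub> g') # w)"
| "letter_mult G H (Inr h) (Inr h' # w) =
     (if h \<otimes>\<^bsub>H\<^esub> h' = \<one>\<^bsub>H\<^esub> then w else Inr (h \<otimes>\<^bsub>H\<^esub> h') # w)"
| "letter_mult G H x w = x # w"

definition free_product ::
    "('a, 'm) monoid_scheme \<Rightarrow> ('b, 'n) monoid_scheme \<Rightarrow> ('a + 'b) list monoid" where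
  "free_product G H =
     \<lparr>carrier = reduced_words G H, mult = foldr (letter_mult G H), one = []\<rparr>"

lemma free_product_simps [simp]:
  "carrier (free_product G H) = reduced_words G H"
  "u \<otimes>\<^bsub>free_product G H\<^esub> v = foldr (letter_mult G H) u v"
  "\<one>\<^bsub>free_product G H\<^esub> = []"
  by (simp_all add: free_product_def)

lemma reduced_words_Nil [simp]: "[] \<in> reduced_words G H"
  by (simp add: reduced_words_def)

lemma reduced_words_Cons:
  "x # w \<in> reduced_words G H \<longleftrightarrow>
     x \<in> free_product_letters G H \<and> w \<in> reduced_words G H \<and> (w = [] \<or> isl x \<noteq> isl (hd w))"
  by (cases w) (auto simp: reduced_words_def)

lemma Inl_letter [simp]: "Inl g \<in> free_product_letters G H \<longleftrightarrow> g \<in> carrier G \<and> g \<noteq> \<one>\<^bsub>G\<^esub>"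
  and Inr_letter [simp]: "Inr h \<in> free_product_letters G H \<longleftrightarrow> h \<in> carrier H \<and> h \<noteq> \<one>\<^bsub>H\<^esub>"
  by (auto simp: free_product_letters_def)

context
  fixes G :: "('a, 'm) monoid_scheme" and H :: "('b, 'n) monoid_scheme"
  assumes G: "group G" and H: "group H"
begin

interpretation G: group G by (rule G)
interpretation H: group H by (rule H)

lemma letter_mult_reduced:
  assumes "x \<in> free_product_letters G H" "w \<in> reduced_words G H"
  shows "letter_mult G H x w \<in> reduced_words G H"
  using assms
  by (cases "(G, H, x, w)" rule: letter_mult.cases) (auto simp: reduced_words_Cons)

lemma foldr_letter_mult_reduced:
  assumes "set u \<subseteq> free_product_letters G H" "w \<in> reduced_words G H"
  shows "foldr (letter_mult G H) u w \<in> reduced_words G H"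
  using assms by (induction u) (auto intro: letter_mult_reduced)

lemma letter_mult_Inl_Inl:
  assumes "g \<in> carrier G" "g \<noteq> \<one>\<^bsub>G\<^esub>" "g' \<in> carrier G" "g' \<noteq> \<one>\<^bsub>G\<^esub>" "w \<in> reduced_words G H"
  shows "letter_mult G H (Inl g) (letter_mult G H (Inl g') w) =
    (if g \<otimes>\<^bsub>G\<^esub> g' = \<one>\<^bsub>G\<^esub> then w else letter_mult G H (Inl (g \<otimes>\<^bsub>G\<^esub> g')) w)"
proof (cases "\<exists>k v. w = Inl k # v")
  case False
  then have "letter_mult G H (Inl x) w = Inl x # w" for x
    by (cases w; cases "hd w") auto
  then show ?thesis by simp
next
  case True
  then obtain k v where w: "w = Inl k # v" by blast
  have v: "k \<in> carrier G" "k \<noteq> \<one>\<^bsub>G\<^esub>" "v = [] \<or> \<not> isl (hd v)"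
    using assms(5) by (auto simp: w reduced_words_Cons)
  have lv: "letter_mult G H (Inl x) v = Inl x # v" for x
    using v(3) by (cases v; cases "hd v") auto
  have assoc: "g \<otimes>\<^bsub>G\<^esub> (g' \<otimes>\<^bsub>G\<^esub> k) = g \<otimes>\<^bsub>G\<^esub> g' \<otimes>\<^bsub>G\<^esub> k"
    using assms v by (simp add: G.m_assoc)
  show ?thesis
  proof (cases "g' \<otimes>\<^bsub>G\<^esub> k = \<one>\<^bsub>G\<^esub>")
    case True
    then have gk: "g \<otimes>\<^bsub>G\<^esub> g' \<otimes>\<^bsub>G\<^esub> k = g" using assoc assms by simp
    show ?thesis
    proof (cases "g \<otimes>\<^bsub>G\<^esub> g' = \<one>\<^bsub>G\<^esub>")
      case True
      then have "k = g" using gk v by simp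
      then show ?thesis using \<open>g' \<otimes>\<^bsub>G\<^esub> k = \<one>\<^bsub>G\<^esub>\<close> True lv by (simp add: w)
    qed (use True gk lv assms in \<open>simp add: w\<close>)
  next
    case False
    then show ?thesis using assoc assms v by (auto simp: w)
  qed
qed

lemma letter_mult_Inr_Inr:
  assumes "g \<in> carrier H" "g \<noteq> \<one>\<^bsub>H\<^esub>" "g' \<in> carrier H" "g' \<noteq> \<one>\<^bsub>H\<^esub>" "w \<in> reduced_words G H"
  shows "letter_mult G H (Inr g) (letter_mult G H (Inr g') w) =
    (if g \<otimes>\<^bsub>H\<^esub> g' = \<one>\<^bsub>H\<^esub> then w else letter_mult G H (Inr (g \<otimes>\<^bsub>H\<^esub> g')) w)"
proof (cases "\<exists>k v. w = Inr k # v")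
  case False
  then have "letter_mult G H (Inr x) w = Inr x # w" for x
    by (cases w; cases "hd w") auto
  then show ?thesis by simp
next
  case True
  then obtain k v where w: "w = Inr k # v" by blast
  have v: "k \<in> carrier H" "k \<noteq> \<one>\<^bsub>H\<^esub>" "v = [] \<or> isl (hd v)"
    using assms(5) by (auto simp: w reduced_words_Cons)
  have lv: "letter_mult G H (Inr x) v = Inr x # v" for x
    using v(3) by (cases v; cases "hd v") auto
  have assoc: "g \<otimes>\<^bsub>H\<^esub> (g' \<otimes>\<^bsub>H\<^esub> k) = g \<otimes>\<^bsub>H\<^esub> g' \<otimes>\<^bsub>H\<^esub> k"
    using assms v by (simp add: H.m_assoc)
  show ?thesis
  proof (cases "g' \<otimes>\<^bsub>H\<^esub> k = \<one>\<^bsub>H\<^esub>")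
    case True
    then have gk: "g \<otimes>\<^bsub>H\<^esub> g' \<otimes>\<^bsub>H\<^esub> k = g" using assoc assms by simp
    show ?thesis
    proof (cases "g \<otimes>\<^bsub>H\<^esub> g' = \<one>\<^bsub>H\<^esub>")
      case True
      then have "k = g" using gk v by simp
      then show ?thesis using \<open>g' \<otimes>\<^bsub>H\<^esub> k = \<one>\<^bsub>H\<^esub>\<close> True lv by (simp add: w)
    qed (use True gk lv assms in \<open>simp add: w\<close>)
  next
    case False
    then show ?thesis using assoc assms v by (auto simp: w)
  qed
qed

lemma foldr_letter_mult:
  assumes "x \<in> free_product_letters G H" "v \<in> reduced_words G H" "w \<in> reduced_words G H"
  shows "foldr (letter_mult G H) (letter_mult G H x v) w =
    letter_mult G H x (foldr (letter_mult G H) v w)"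
proof -
  have "foldr (letter_mult G H) u w \<in> reduced_words G H" if "u \<in> reduced_words G H" for u
    using that assms(3) by (intro foldr_letter_mult_reduced) (auto simp: reduced_words_def)
  note red = this
  show ?thesis
  proof (cases "v = [] \<or> isl x \<noteq> isl (hd v)")
    case True
    then have "letter_mult G H x v = x # v"
      by (cases v; cases x; cases "hd v") auto
    then show ?thesis by simp
  next
    case False
    then obtain y u where v: "v = y # u" "isl x = isl y" by (cases v) auto
    have y: "y \<in> free_product_letters G H" and u: "u \<in> reduced_words G H"
      using assms(2) unfolding v(1) reduced_words_Cons by blast+
    have W: "foldr (letter_mult G H) u w \<in> reduced_words G H" by (rule red[OF u])
    show ?thesis
    proof (cases x)
      case (Inl g)
      then obtain g' where "y = Inl g'" using v(2) by (cases y) auto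
      then show ?thesis
        using assms(1) y letter_mult_Inl_Inl[OF _ _ _ _ W, of g g'] by (simp add: v(1) Inl)
    next
      case (Inr h)
      then obtain h' where "y = Inr h'" using v(2) by (cases y) auto
      then show ?thesis
        using assms(1) y letter_mult_Inr_Inr[OF _ _ _ _ W, of h h'] by (simp add: v(1) Inr)
    qed
  qed
qed

lemma foldr_letter_mult_assoc:
  assumes "set u \<subseteq> free_product_letters G H" "v \<in> reduced_words G H" "w \<in> reduced_words G H"
  shows "foldr (letter_mult G H) (foldr (letter_mult G H) u v) w =
    foldr (letter_mult G H) u (foldr (letter_mult G H) v w)"
  using assms by (induction u) (auto simp: foldr_letter_mult foldr_letter_mult_reduced)

lemma foldr_letter_mult_Nil: "u \<in> reduced_words G H \<Longrightarrow> foldr (letter_mult G H) u [] = u"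
proof (induction u)
  case (Cons x u)
  then have "foldr (letter_mult G H) u [] = u" and "u = [] \<or> isl x \<noteq> isl (hd u)"
    by (auto simp: reduced_words_Cons)
  then show ?case
    by (cases u; cases x; cases "hd u") auto
qed simp

lemma free_product_left_inverse:
  assumes "u \<in> reduced_words G H"
  shows "\<exists>v\<in>reduced_words G H. foldr (letter_mult G H) v u = []"
  using assms
proof (induction u)
  case Nil
  show ?case by (rule bexI[of _ "[]"]) auto
next
  case (Cons x u)
  then obtain v where v: "v \<in> reduced_words G H" "foldr (letter_mult G H) v u = []"
    by (auto simp: reduced_words_Cons)
  have u: "x \<in> free_product_letters G H" "u \<in> reduced_words G H"
    using Cons.prems by (auto simp: reduced_words_Cons)
  obtain y where y: "y \<in> free_product_letters G H" "letter_mult G H y (x # u) = u"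
  proof (cases x)
    case (Inl g)
    with u that[of "Inl (inv\<^bsub>G\<^esub> g)"] show thesis by auto
  next
    case (Inr h)
    with u that[of "Inr (inv\<^bsub>H\<^esub> h)"] show thesis by auto
  qed
  define z where "z = foldr (letter_mult G H) v [y]"
  have y1: "[y] \<in> reduced_words G H" using y by (simp add: reduced_words_Cons)
  have sv: "set v \<subseteq> free_product_letters G H" using v by (simp add: reduced_words_def)
  have "z \<in> reduced_words G H"
    unfolding z_def using sv y1 by (rule foldr_letter_mult_reduced)
  moreover have "foldr (letter_mult G H) z (x # u) = []"
    unfolding z_def using foldr_letter_mult_assoc[OF sv y1 Cons.prems] y v by simp
  ultimately show ?case by blast
qed

lemma group_free_product: "group (free_product G H)"
proof (rule groupI)
  show "x \<otimes>\<^bsub>free_product G H\<^esub> y \<in> carrier (free_product G H)"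
    if "x \<in> carrier (free_product G H)" "y \<in> carrier (free_product G H)" for x y
    using that foldr_letter_mult_reduced[of x y] by (simp add: reduced_words_def)
  show "x \<otimes>\<^bsub>free_product G H\<^esub> y \<otimes>\<^bsub>free_product G H\<^esub> z =
      x \<otimes>\<^bsub>free_product G H\<^esub> (y \<otimes>\<^bsub>free_product G H\<^esub> z)"
    if "x \<in> carrier (free_product G H)" "y \<in> carrier (free_product G H)"
       "z \<in> carrier (free_product G H)" for x y z
    using that foldr_letter_mult_assoc[of x y z] by (simp add: reduced_words_def)
qed (auto dest: free_product_left_inverse)

text \<open>Universal property: together with the two canonical inclusions, the group of reduced words is
  the coproduct of the factors.\<close>

definition free_product_Inl :: "'a \<Rightarrow> ('a + 'b) list" where
  "free_product_Inl g = (if g = \<one>\<^bsub>G\<^esub> then [] else [Inl g])"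

definition free_product_Inr :: "'b \<Rightarrow> ('a + 'b) list" where
  "free_product_Inr h = (if h = \<one>\<^bsub>H\<^esub> then [] else [Inr h])"

lemma free_product_Inl_hom: "free_product_Inl \<in> hom G (free_product G H)"
  by (auto simp: hom_def free_product_Inl_def reduced_words_Cons)

lemma free_product_Inr_hom: "free_product_Inr \<in> hom H (free_product G H)"
  by (auto simp: hom_def free_product_Inr_def reduced_words_Cons)

lemma free_product_universal:
  fixes K :: "('c, 'k) monoid_scheme"
  assumes K: "group K" and f: "f \<in> hom G K" and h: "h \<in> hom H K"
  shows "\<exists>F\<in>hom (free_product G H) K.
    (\<forall>g\<in>carrier G. F (free_product_Inl g) = f g) \<and>
    (\<forall>g\<in>carrier H. F (free_product_Inr g) = h g)"
proof -
  interpret K: group K by (rule K)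
  interpret f: group_hom G K f using f G K by (simp add: group_hom_def group_hom_axioms_def)
  interpret h: group_hom H K h using h H K by (simp add: group_hom_def group_hom_axioms_def)
  define e where "e = case_sum f h"
  define F where "F = foldr (\<lambda>x k. e x \<otimes>\<^bsub>K\<^esub> k)"
  have e: "e x \<in> carrier K" if "x \<in> free_product_letters G H" for x
    using that by (cases x) (auto simp: e_def)
  have Fc: "F u \<one>\<^bsub>K\<^esub> \<in> carrier K" if "u \<in> reduced_words G H" for u
    using that by (induction u) (auto simp: F_def reduced_words_Cons e)
  have step: "F (letter_mult G H x w) \<one>\<^bsub>K\<^esub> = e x \<otimes>\<^bsub>K\<^esub> F w \<one>\<^bsub>K\<^esub>"
    if x: "x \<in> free_product_letters G H" and w: "w \<in> reduced_words G H" for x w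
  proof (cases "w = [] \<or> isl x \<noteq> isl (hd w)")
    case True
    then have "letter_mult G H x w = x # w"
      by (cases w; cases x; cases "hd w") auto
    then show ?thesis by (simp add: F_def)
  next
    case False
    then obtain y u where w': "w = y # u" "isl x = isl y" by (cases w) auto
    have yl: "y \<in> free_product_letters G H" and "u \<in> reduced_words G H"
      using w unfolding w'(1) reduced_words_Cons by blast+
    then have Fu: "F u \<one>\<^bsub>K\<^esub> \<in> carrier K" by (intro Fc)
    show ?thesis
    proof (cases x)
      case (Inl g)
      then obtain g' where y: "y = Inl g'" using w'(2) by (cases y) auto
      have "f g \<otimes>\<^bsub>K\<^esub> (f g' \<otimes>\<^bsub>K\<^esub> F u \<one>\<^bsub>K\<^esub>) = f (g \<otimes>\<^bsub>G\<^esub> g') \<otimes>\<^bsub>K\<^esub> F u \<one>\<^bsub>K\<^esub>"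
        using x y yl Fu by (simp add: Inl K.m_assoc)
      then show ?thesis
        using Fu f.hom_one by (simp add: F_def e_def w'(1) y Inl)
    next
      case (Inr g)
      then obtain g' where y: "y = Inr g'" using w'(2) by (cases y) auto
      have "h g \<otimes>\<^bsub>K\<^esub> (h g' \<otimes>\<^bsub>K\<^esub> F u \<one>\<^bsub>K\<^esub>) = h (g \<otimes>\<^bsub>H\<^esub> g') \<otimes>\<^bsub>K\<^esub> F u \<one>\<^bsub>K\<^esub>"
        using x y yl Fu by (simp add: Inr K.m_assoc)
      then show ?thesis
        using Fu h.hom_one by (simp add: F_def e_def w'(1) y Inr)
    qed
  qed
  have mult: "F (foldr (letter_mult G H) u w) \<one>\<^bsub>K\<^esub> = F u \<one>\<^bsub>K\<^esub> \<otimes>\<^bsub>K\<^esub> F w \<one>\<^bsub>K\<^esub>"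
    if "u \<in> reduced_words G H" "w \<in> reduced_words G H" for u w
    using that
  proof (induction u)
    case Nil
    then show ?case using Fc by (simp add: F_def)
  next
    case (Cons x u)
    then have x: "x \<in> free_product_letters G H" "u \<in> reduced_words G H"
      by (auto simp: reduced_words_Cons)
    have "foldr (letter_mult G H) u w \<in> reduced_words G H"
      using x Cons.prems by (intro foldr_letter_mult_reduced) (auto simp: reduced_words_def)
    then have "F (foldr (letter_mult G H) (x # u) w) \<one>\<^bsub>K\<^esub> =
        e x \<otimes>\<^bsub>K\<^esub> (F u \<one>\<^bsub>K\<^esub> \<otimes>\<^bsub>K\<^esub> F w \<one>\<^bsub>K\<^esub>)"
      using x Cons by (simp add: step)
    also have "\<dots> = F (x # u) \<one>\<^bsub>K\<^esub> \<otimes>\<^bsub>K\<^esub> F w \<one>\<^bsub>K\<^esub>"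
      using x Cons.prems Fc[of u] Fc[of w] e[of x] by (simp add: F_def K.m_assoc)
    finally show ?case .
  qed
  have "(\<lambda>u. F u \<one>\<^bsub>K\<^esub>) \<in> hom (free_product G H) K"
    using Fc mult by (auto simp: hom_def)
  moreover have "\<forall>g\<in>carrier G. F (free_product_Inl g) \<one>\<^bsub>K\<^esub> = f g"
    by (auto simp: F_def e_def free_product_Inl_def)
  moreover have "\<forall>g\<in>carrier H. F (free_product_Inr g) \<one>\<^bsub>K\<^esub> = h g"
    by (auto simp: F_def e_def free_product_Inr_def)
  ultimately show ?thesis by (intro bexI[of _ "\<lambda>u. F u \<one>\<^bsub>K\<^esub>"] conjI)
qed

lemma free_product_universal_unique:
  fixes K :: "('c, 'k) monoid_scheme"
  assumes K: "group K" and F: "F \<in> hom (free_product G H) K" and F': "F' \<in> hom (free_product G H) K"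
    and eq: "\<And>g. g \<in> carrier G \<Longrightarrow> F (free_product_Inl g) = F' (free_product_Inl g)"
      "\<And>g. g \<in> carrier H \<Longrightarrow> F (free_product_Inr g) = F' (free_product_Inr g)"
    and u: "u \<in> carrier (free_product G H)"
  shows "F u = F' u"
  using u
proof (induction u)
  case Nil
  then show ?case using eq(1)[of "\<one>\<^bsub>G\<^esub>"] by (simp add: free_product_Inl_def)
next
  case (Cons x u)
  then have x: "[x] \<in> reduced_words G H" "u \<in> reduced_words G H"
    "x \<in> free_product_letters G H"
    by (auto simp: reduced_words_Cons)
  have xu: "x # u = [x] \<otimes>\<^bsub>free_product G H\<^esub> u"
    using Cons.prems foldr_letter_mult_Nil[of "x # u"] foldr_letter_mult_Nil[of u]
    by (auto simp: reduced_words_Cons)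
  have "F [x] = F' [x]"
  proof (cases x)
    case (Inl g)
    with x eq(1)[of g] show ?thesis by (simp add: free_product_Inl_def)
  next
    case (Inr h)
    with x eq(2)[of h] show ?thesis by (simp add: free_product_Inr_def)
  qed
  then show ?case
    using x Cons.IH hom_mult[OF F, of "[x]" u] hom_mult[OF F', of "[x]" u] unfolding xu by simp
qed

end

section \<open>Left-preorders\<close>

definition left_preorder :: "('a, 'm) monoid_scheme \<Rightarrow> 'a rel \<Rightarrow> bool" where
  "left_preorder G R \<longleftrightarrow>
     preorder_on (carrier G) R \<and> total_on (carrier G) R \<and>
     (\<forall>g\<in>carrier G. \<forall>g1\<in>carrier G. \<forall>g2\<in>carrier G.
        (g1, g2) \<in> R \<longrightarrow> (g \<otimes>\<^bsub>G\<^esub> g1, g \<otimes>\<^bsub>G\<^esub> g2) \<in> R) \<and>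
     R \<noteq> carrier G \<times> carrier G"

definition preorder_core :: "('a, 'm) monoid_scheme \<Rightarrow> 'a rel \<Rightarrow> 'a set" where
  "preorder_core G R = {g \<in> carrier G. (g, \<one>\<^bsub>G\<^esub>) \<in> R \<and> (\<one>\<^bsub>G\<^esub>, g) \<in> R}"

definition left_preorder_rel :: "('a, 'm) monoid_scheme \<Rightarrow> 'a set \<Rightarrow> 'a rel \<Rightarrow> bool" where
  "left_preorder_rel G C R \<longleftrightarrow> left_preorder G R \<and> preorder_core G R = C"

definition positive_cone :: "('a, 'm) monoid_scheme \<Rightarrow> 'a rel \<Rightarrow> 'a set" where
  "positive_cone G R = {g \<in> carrier G. (\<one>\<^bsub>G\<^esub>, g) \<in> R \<and> g \<notin> preorder_core G R}"

definition left_relatively_convex :: "('a, 'm) monoid_scheme \<Rightarrow> 'a set \<Rightarrow> bool" where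
  "left_relatively_convex G C \<longleftrightarrow>
     subgroup C G \<and> C \<noteq> carrier G \<and> (\<exists>R. left_preorder_rel G C R)"

definition preorder_map :: "('a, 'm) monoid_scheme \<Rightarrow> 'a rel \<Rightarrow> 'a \<Rightarrow> int" where
  "preorder_map G R =
     (\<lambda>g\<in>carrier G. if g \<in> positive_cone G R then 1
                    else if inv\<^bsub>G\<^esub> g \<in> positive_cone G R then -1 else 0)"

definition PO :: "('a, 'm) monoid_scheme \<Rightarrow> 'a set \<Rightarrow> ('a \<Rightarrow> int) set" where
  "PO G C = preorder_map G ` {R. left_preorder_rel G C R}"

definition PO_topology :: "('a, 'm) monoid_scheme \<Rightarrow> 'a set \<Rightarrow> ('a \<Rightarrow> int) topology" where
  "PO_topology G C =
     subtopology (product_topology (\<lambda>_. discrete_topology {1, -1, 0}) (carrier G)) (PO G C)"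

lemma topspace_PO_topology: "topspace (PO_topology G C) = PO G C"
proof -
  have "preorder_map G R \<in> carrier G \<rightarrow>\<^sub>E {1, -1, 0}" for R
    unfolding preorder_map_def by (intro restrict_PiE_iff[THEN iffD2] ballI) simp
  then show ?thesis
    by (auto simp: PO_topology_def PO_def)
qed

text \<open>Preorders may be identified with their maps.\<close>

lemma inj_on_preorder_map:
  assumes "group G"
  shows "inj_on (preorder_map G) {R. left_preorder G R}"
proof -
  interpret group G by (rule assms)
  have key: "(a, b) \<in> R \<longleftrightarrow>
      a \<in> carrier G \<and> b \<in> carrier G \<and> preorder_map G R (inv\<^bsub>G\<^esub> a \<otimes>\<^bsub>G\<^esub> b) \<noteq> -1"
    if R: "left_preorder G R" for R a b
  proof -
    have sub: "R \<subseteq> carrier G \<times> carrier G" and refl: "refl_on (carrier G) R"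
      and total: "total_on (carrier G) R"
      using R by (simp_all add: left_preorder_def preorder_on_def)
    have tot: "(x, y) \<in> R \<or> (y, x) \<in> R" if "x \<in> carrier G" "y \<in> carrier G" for x y
      using that refl_onD[OF refl, of x] total by (cases "x = y") (auto simp: total_on_def)
    have inv: "(g \<otimes>\<^bsub>G\<^esub> x, g \<otimes>\<^bsub>G\<^esub> y) \<in> R" if "g \<in> carrier G" "(x, y) \<in> R" for g x y
    proof -
      have "x \<in> carrier G" "y \<in> carrier G" using sub that by auto
      then show ?thesis using R that by (simp add: left_preorder_def)
    qed
    have inv1: "(\<one>\<^bsub>G\<^esub>, inv\<^bsub>G\<^esub> x) \<in> R \<longleftrightarrow> (x, \<one>\<^bsub>G\<^esub>) \<in> R"
        "(inv\<^bsub>G\<^esub> x, \<one>\<^bsub>G\<^esub>) \<in> R \<longleftrightarrow> (\<one>\<^bsub>G\<^esub>, x) \<in> R" if x: "x \<in> carrier G" for x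
      using inv[OF x, of "\<one>\<^bsub>G\<^esub>" "inv\<^bsub>G\<^esub> x"] inv[OF inv_closed[OF x], of x "\<one>\<^bsub>G\<^esub>"]
        inv[OF x, of "inv\<^bsub>G\<^esub> x" "\<one>\<^bsub>G\<^esub>"] inv[OF inv_closed[OF x], of "\<one>\<^bsub>G\<^esub>" x] x
      unfolding r_one[OF x] r_inv[OF x] l_inv[OF x] r_one[OF inv_closed[OF x]] by iprover+
    have neg: "preorder_map G R x \<noteq> -1 \<longleftrightarrow> (\<one>\<^bsub>G\<^esub>, x) \<in> R" if x: "x \<in> carrier G" for x
      using x inv1[OF x] tot[OF one_closed x]
      by (simp add: preorder_map_def positive_cone_def preorder_core_def) blast
    have "(a, b) \<in> R \<longleftrightarrow> (\<one>\<^bsub>G\<^esub>, inv\<^bsub>G\<^esub> a \<otimes>\<^bsub>G\<^esub> b) \<in> R"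
      if a: "a \<in> carrier G" and b: "b \<in> carrier G"
    proof -
      have "a \<otimes>\<^bsub>G\<^esub> (inv\<^bsub>G\<^esub> a \<otimes>\<^bsub>G\<^esub> b) = b"
        using a b by (simp add: m_assoc[symmetric])
      then show ?thesis
        using inv[OF inv_closed[OF a], of a b] inv[OF a, of "\<one>\<^bsub>G\<^esub>" "inv\<^bsub>G\<^esub> a \<otimes>\<^bsub>G\<^esub> b"]
        unfolding l_inv[OF a] r_one[OF a] by auto
    qed
    moreover have "inv\<^bsub>G\<^esub> a \<otimes>\<^bsub>G\<^esub> b \<in> carrier G" if "a \<in> carrier G" "b \<in> carrier G"
      using that by simp
    ultimately show ?thesis using sub neg by blast
  qed
  show ?thesis
  proof (rule inj_onI)
    fix R S
    assume "R \<in> {R. left_preorder G R}" "S \<in> {R. left_preorder G R}"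
      and eq: "preorder_map G R = preorder_map G S"
    then have "(a, b) \<in> R \<longleftrightarrow> (a, b) \<in> S" for a b
      using key[of R a b] key[of S a b] by simp
    then show "R = S" by auto
  qed
qed

definition finitely_generated_subgroup :: "('a, 'm) monoid_scheme \<Rightarrow> 'a set \<Rightarrow> bool" where
  "finitely_generated_subgroup G C \<longleftrightarrow> (\<exists>S. finite S \<and> S \<subseteq> carrier G \<and> C = generate G S)"

definition isolated_element :: "'a topology \<Rightarrow> 'a \<Rightarrow> bool" where
  "isolated_element X x \<longleftrightarrow> x \<in> topspace X \<and> openin X {x}"

end

theory Submission
  imports Defs "HOL-Combinatorics.Transposition" "HOL-Library.Function_Algebras"
begin

text \<open>A left-preorder relative to \<open>C\<close> is read off from the action of the free product on an ordered
  set containing the cosets of \<open>C\<close>, by comparing the images of the coset \<open>C\<close>. Suppose finitely many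
  signs determine the preorder. The suffixes of the corresponding words and of the generators of
  \<open>C\<close> move the base point to finitely many points; let \<open>v\<close> represent the largest. Some element
  \<open>g\<close> of one factor pushes it further up. Conjugating the action of the other factor by an
  automorphism that is trivial up to \<open>g v\<close> changes neither the given signs nor the fact that \<open>C\<close>
  fixes the base point, but it can reverse the comparison of \<open>h g v\<close> with \<open>g g v\<close> for a suitable
  \<open>h\<close> in the other factor. To have enough automorphisms, the cosets are embedded into the
  finitely supported integer functions on the finitely supported integer functions on the cosets,
  ordered lexicographically: there an increasing bijection can be glued from the identity below a
  point and, above it, a shift of the exponents recentred at that point.\<close>

section \<open>Groups of order automorphisms\<close>

text \<open>Orders are predicates relativised to a set: they are built from a given preorder, and
  the same point type is also used for permutations that ignore the order.\<close>

definition strict_linear_on :: "'a set \<Rightarrow> ('a \<Rightarrow> 'a \<Rightarrow> bool) \<Rightarrow> bool" where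
  "strict_linear_on Y lt \<longleftrightarrow> (\<forall>x\<in>Y. \<not> lt x x) \<and>
     (\<forall>x\<in>Y. \<forall>y\<in>Y. \<forall>z\<in>Y. lt x y \<longrightarrow> lt y z \<longrightarrow> lt x z) \<and>
     (\<forall>x\<in>Y. \<forall>y\<in>Y. x = y \<or> lt x y \<or> lt y x)"

lemma strict_linear_onD:
  assumes "strict_linear_on Y lt"
  shows "x \<in> Y \<Longrightarrow> \<not> lt x x"
    and "x \<in> Y \<Longrightarrow> y \<in> Y \<Longrightarrow> z \<in> Y \<Longrightarrow> lt x y \<Longrightarrow> lt y z \<Longrightarrow> lt x z"
    and "x \<in> Y \<Longrightarrow> y \<in> Y \<Longrightarrow> x = y \<or> lt x y \<or> lt y x"
  using assms unfolding strict_linear_on_def by blast+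

lemma strict_linear_on_finite_max:
  assumes lin: "strict_linear_on Y lt" and D: "finite D" "D \<noteq> {}" "D \<subseteq> Y"
  obtains m where "m \<in> D" "\<And>x. x \<in> D \<Longrightarrow> x = m \<or> lt x m"
proof -
  have "asymp_on D lt"
    using strict_linear_onD(1,2)[OF lin] D(3) by (intro asymp_onI) blast
  moreover have "transp_on D lt"
    using strict_linear_onD(2)[OF lin] D(3) by (intro transp_onI) blast
  ultimately obtain m where "m \<in> D" "\<forall>x\<in>D. x \<noteq> m \<longrightarrow> \<not> lt m x"
    using Finite_Set.bex_max_element[OF D(1) _ _ D(2)] by blast
  then show thesis
    using that strict_linear_onD(3)[OF lin] D(3) by blast
qed

text \<open>The maps are bijections of the whole type, so that multiplication is plain composition
  with unit \<open>id\<close>. Only their behaviour on \<open>Y\<close> is constrained. With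
  \<open>Y = UNIV\<close> and the empty relation this is the full symmetric group.\<close>

definition order_auts :: "'a set \<Rightarrow> ('a \<Rightarrow> 'a \<Rightarrow> bool) \<Rightarrow> ('a \<Rightarrow> 'a) set" where
  "order_auts Y lt = {\<sigma>. bij \<sigma> \<and> \<sigma> ` Y = Y \<and> (\<forall>x\<in>Y. \<forall>y\<in>Y. lt (\<sigma> x) (\<sigma> y) \<longleftrightarrow> lt x y)}"

lemma order_auts_closed: "\<sigma> \<in> order_auts Y lt \<Longrightarrow> y \<in> Y \<Longrightarrow> \<sigma> y \<in> Y"
  by (auto simp: order_auts_def)

lemma order_auts_less_iff:
  "\<sigma> \<in> order_auts Y lt \<Longrightarrow> x \<in> Y \<Longrightarrow> y \<in> Y \<Longrightarrow> lt (\<sigma> x) (\<sigma> y) \<longleftrightarrow> lt x y"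
  by (auto simp: order_auts_def)

lemma order_autsI:
  assumes "\<And>x. \<tau> (\<sigma> x) = x" "\<And>x. \<sigma> (\<tau> x) = x"
    and "\<And>y. y \<in> Y \<Longrightarrow> \<sigma> y \<in> Y" "\<And>y. y \<in> Y \<Longrightarrow> \<tau> y \<in> Y"
    and "\<And>x y. x \<in> Y \<Longrightarrow> y \<in> Y \<Longrightarrow> lt x y \<Longrightarrow> lt (\<sigma> x) (\<sigma> y)"
    and "\<And>x y. x \<in> Y \<Longrightarrow> y \<in> Y \<Longrightarrow> lt x y \<Longrightarrow> lt (\<tau> x) (\<tau> y)"
  shows "\<sigma> \<in> order_auts Y lt"
proof -
  have "bij \<sigma>" by (rule o_bij[of \<tau>]) (use assms in \<open>auto simp: fun_eq_iff\<close>)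
  moreover have "\<sigma> ` Y = Y"
  proof
    show "Y \<subseteq> \<sigma> ` Y"
    proof
      fix y assume "y \<in> Y"
      then show "y \<in> \<sigma> ` Y" using assms(2)[of y] assms(4)[of y] by (intro image_eqI[of _ _ "\<tau> y"]) auto
    qed
  qed (use assms(3) in auto)
  moreover have "lt (\<sigma> x) (\<sigma> y) \<longleftrightarrow> lt x y" if "x \<in> Y" "y \<in> Y" for x y
    using that assms(1)[of x] assms(1)[of y] assms(3)[of x] assms(3)[of y]
      assms(5)[of x y] assms(6)[of "\<sigma> x" "\<sigma> y"] by metis
  ultimately show ?thesis by (simp add: order_auts_def)
qed

lemma id_order_auts: "id \<in> order_auts Y lt"
  by (simp add: order_auts_def)

lemma comp_order_auts:
  assumes "\<sigma> \<in> order_auts Y lt" "\<tau> \<in> order_auts Y lt"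
  shows "\<sigma> \<circ> \<tau> \<in> order_auts Y lt"
proof -
  have "bij (\<sigma> \<circ> \<tau>)" using assms by (simp add: order_auts_def bij_comp)
  moreover have "(\<sigma> \<circ> \<tau>) ` Y = Y" unfolding image_comp[symmetric] using assms by (simp add: order_auts_def)
  ultimately show ?thesis
    using assms by (simp add: order_auts_def order_auts_closed[OF assms(2)])
qed

lemma inv_order_auts:
  assumes "\<sigma> \<in> order_auts Y lt"
  shows "inv_into UNIV \<sigma> \<in> order_auts Y lt"
proof (rule order_autsI)
  have b: "bij \<sigma>" and Y: "\<sigma> ` Y = Y" using assms by (auto simp: order_auts_def)
  show "\<sigma> (inv_into UNIV \<sigma> x) = x" "inv_into UNIV \<sigma> (\<sigma> x) = x" for x
    using b by (simp_all add: bij_is_surj surj_f_inv_f bij_is_inj inv_f_f)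
  have c: "inv_into UNIV \<sigma> y \<in> Y" if "y \<in> Y" for y
  proof -
    have "y \<in> \<sigma> ` Y" using Y that by simp
    then obtain x where "x \<in> Y" "y = \<sigma> x" by (rule imageE)
    then show ?thesis using b by (simp add: bij_is_inj)
  qed
  then show "y \<in> Y \<Longrightarrow> inv_into UNIV \<sigma> y \<in> Y" for y .
  show "lt (inv_into UNIV \<sigma> x) (inv_into UNIV \<sigma> y)" if "x \<in> Y" "y \<in> Y" "lt x y" for x y
    using order_auts_less_iff[OF assms c[OF that(1)] c[OF that(2)]] that(3) b
    by (simp add: bij_is_surj surj_f_inv_f)
qed (use assms in \<open>auto simp: order_auts_closed order_auts_less_iff\<close>)

definition perm_group :: "('a \<Rightarrow> 'a) set \<Rightarrow> ('a \<Rightarrow> 'a) monoid" where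
  "perm_group S = \<lparr>carrier = S, mult = (\<circ>), one = id\<rparr>"

lemma perm_group_simps [simp]:
  "carrier (perm_group S) = S" "\<sigma> \<otimes>\<^bsub>perm_group S\<^esub> \<tau> = \<sigma> \<circ> \<tau>" "\<one>\<^bsub>perm_group S\<^esub> = id"
  by (simp_all add: perm_group_def)

lemma group_order_auts: "group (perm_group (order_auts Y lt))"
proof (rule groupI)
  show "\<exists>\<tau>\<in>carrier (perm_group (order_auts Y lt)).
      \<tau> \<otimes>\<^bsub>perm_group (order_auts Y lt)\<^esub> \<sigma> = \<one>\<^bsub>perm_group (order_auts Y lt)\<^esub>"
    if "\<sigma> \<in> carrier (perm_group (order_auts Y lt))" for \<sigma>
    using that inv_order_auts[of \<sigma> Y lt]
    by (intro bexI[of _ "inv_into UNIV \<sigma>"]) (auto simp: order_auts_def bij_is_inj)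
qed (auto simp: comp_order_auts id_order_auts o_assoc)

section \<open>Lexicographically ordered finitely supported functions\<close>

definition fin_supp_funs :: "'a set \<Rightarrow> ('a \<Rightarrow> int) set" where
  "fin_supp_funs Y = {f. finite {x. f x \<noteq> 0} \<and> {x. f x \<noteq> 0} \<subseteq> Y}"

text \<open>The largest point of difference decides. Finite support provides such a point, and
  invariance under addition makes the finitely supported functions an ordered abelian group when
  \<open>lt\<close> is a strict linear order on \<open>Y\<close>.\<close>

definition lex_less :: "'a set \<Rightarrow> ('a \<Rightarrow> 'a \<Rightarrow> bool) \<Rightarrow> ('a \<Rightarrow> int) \<Rightarrow> ('a \<Rightarrow> int) \<Rightarrow> bool" where
  "lex_less Y lt f g \<longleftrightarrow> (\<exists>y\<in>Y. f y < g y \<and> (\<forall>z\<in>Y. lt y z \<longrightarrow> f z = g z))"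

lemma fin_supp_funs_zero [simp]: "0 \<in> fin_supp_funs Y"
  by (simp add: fin_supp_funs_def)

lemma fin_supp_funs_add:
  assumes "f \<in> fin_supp_funs Y" "g \<in> fin_supp_funs Y"
  shows "f + g \<in> fin_supp_funs Y"
proof -
  have "{x. (f + g) x \<noteq> 0} \<subseteq> {x. f x \<noteq> 0} \<union> {x. g x \<noteq> 0}" by auto
  then show ?thesis
    using assms finite_subset unfolding fin_supp_funs_def by blast
qed

lemma fin_supp_funs_minus: "f \<in> fin_supp_funs Y \<Longrightarrow> - f \<in> fin_supp_funs Y"
  by (simp add: fin_supp_funs_def)

lemma fin_supp_funs_diff:
  "f \<in> fin_supp_funs Y \<Longrightarrow> g \<in> fin_supp_funs Y \<Longrightarrow> f - g \<in> fin_supp_funs Y"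
  using fin_supp_funs_add[of f Y "- g"] fin_supp_funs_minus[of g Y] by simp

lemma lex_less_add [simp]: "lex_less Y lt (h + f) (h + g) \<longleftrightarrow> lex_less Y lt f g"
  by (simp add: lex_less_def)

lemma lex_less_minus [simp]: "lex_less Y lt (f - h) (g - h) \<longleftrightarrow> lex_less Y lt f g"
  by (simp add: lex_less_def)

lemma lex_less_diff: "lex_less Y lt 0 (g - f) \<longleftrightarrow> lex_less Y lt f g"
  using lex_less_add[of Y lt f 0 "g - f"] by simp

text \<open>For transitivity, the larger of the two deciding points decides the composite
  comparison. For totality, two distinct functions differ on a finite non-empty set, whose maximum
  decides.\<close>

lemma strict_linear_on_lex_less:
  assumes "strict_linear_on Y lt"
  shows "strict_linear_on (fin_supp_funs Y) (lex_less Y lt)"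
proof -
  note lin = strict_linear_onD[OF assms]
  have trans: "lex_less Y lt f k" if fg: "lex_less Y lt f g" "lex_less Y lt g k" for f g k
  proof -
    obtain x y where x: "x \<in> Y" "f x < g x" "\<forall>z\<in>Y. lt x z \<longrightarrow> f z = g z"
      and y: "y \<in> Y" "g y < k y" "\<forall>z\<in>Y. lt y z \<longrightarrow> g z = k z"
      using fg unfolding lex_less_def by blast
    consider "x = y" | "lt x y" | "lt y x" using lin(3)[OF x(1) y(1)] by blast
    then show ?thesis
    proof cases
      case 1
      then have "f x < k x" "\<forall>z\<in>Y. lt x z \<longrightarrow> f z = k z" using x y by auto
      then show ?thesis using x(1) unfolding lex_less_def by blast
    next
      case 2
      then have "f y < k y" "\<forall>z\<in>Y. lt y z \<longrightarrow> f z = k z"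
        using x y lin(2)[OF x(1) y(1)] by auto
      then show ?thesis using y(1) unfolding lex_less_def by blast
    next
      case 3
      then have "f x < k x" "\<forall>z\<in>Y. lt x z \<longrightarrow> f z = k z"
        using x y lin(2)[OF y(1) x(1)] by auto
      then show ?thesis using x(1) unfolding lex_less_def by blast
    qed
  qed
  have total: "f = g \<or> lex_less Y lt f g \<or> lex_less Y lt g f"
    if "f \<in> fin_supp_funs Y" "g \<in> fin_supp_funs Y" for f g
  proof (cases "f = g")
    case False
    define D where "D = {x. (f - g) x \<noteq> 0}"
    have "finite D" "D \<subseteq> Y" "D \<noteq> {}"
      using fin_supp_funs_diff[OF that] False by (auto simp: fin_supp_funs_def D_def fun_eq_iff)
    then obtain m where m: "m \<in> D" "\<And>x. x \<in> D \<Longrightarrow> x = m \<or> lt x m"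
      using strict_linear_on_finite_max[OF assms] by metis
    have "m \<in> Y" using m \<open>D \<subseteq> Y\<close> by blast
    have "f z = g z" if "z \<in> Y" "lt m z" for z
    proof (rule ccontr)
      assume "f z \<noteq> g z"
      then have "z \<in> D" by (simp add: D_def)
      then show False using m(2)[of z] that lin(1)[of m] lin(2)[of m z m] \<open>m \<in> Y\<close> by blast
    qed
    moreover have "f m < g m \<or> g m < f m" using m(1) by (auto simp: D_def)
    ultimately show ?thesis using \<open>m \<in> Y\<close> unfolding lex_less_def by (metis (no_types))
  qed simp
  have "\<not> lex_less Y lt f f" for f by (simp add: lex_less_def)
  with trans total show ?thesis unfolding strict_linear_on_def by blast
qed

section \<open>Automorphisms induced on spaces of functions\<close>

definition lift_aut :: "('a \<Rightarrow> 'a) \<Rightarrow> ('a \<Rightarrow> int) \<Rightarrow> 'a \<Rightarrow> int" where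
  "lift_aut \<sigma> f = f \<circ> inv_into UNIV \<sigma>"

text \<open>Precomposition with the inverse is covariant, so a left action on points lifts to a left
  action on functions.\<close>

lemma lift_aut_comp: "bij \<sigma> \<Longrightarrow> bij \<tau> \<Longrightarrow> lift_aut (\<sigma> \<circ> \<tau>) = lift_aut \<sigma> \<circ> lift_aut \<tau>"
  by (rule ext) (simp add: lift_aut_def o_inv_distrib o_assoc)

lemma lift_aut_less:
  assumes "\<sigma> \<in> order_auts Y lt" "lex_less Y lt f g"
  shows "lex_less Y lt (lift_aut \<sigma> f) (lift_aut \<sigma> g)"
proof -
  obtain y where y: "y \<in> Y" "f y < g y" "\<forall>z\<in>Y. lt y z \<longrightarrow> f z = g z"
    using assms(2) unfolding lex_less_def by blast
  have b: "bij \<sigma>" using assms(1) by (simp add: order_auts_def)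
  have "f (inv_into UNIV \<sigma> z) = g (inv_into UNIV \<sigma> z)" if z: "z \<in> Y" "lt (\<sigma> y) z" for z
  proof -
    have "inv_into UNIV \<sigma> z \<in> Y" using order_auts_closed[OF inv_order_auts[OF assms(1)] z(1)] .
    moreover from this have "lt y (inv_into UNIV \<sigma> z)"
      using order_auts_less_iff[OF assms(1) y(1), of "inv_into UNIV \<sigma> z"] z b
      by (simp add: bij_is_surj surj_f_inv_f)
    ultimately show ?thesis using y by blast
  qed
  moreover have "\<sigma> y \<in> Y" using order_auts_closed[OF assms(1) y(1)] .
  ultimately show ?thesis
    unfolding lex_less_def lift_aut_def using y b
    by (intro bexI[of _ "\<sigma> y"]) (simp_all add: bij_is_inj)
qed

lemma lift_aut_fin_supp_funs:
  assumes "\<sigma> \<in> order_auts Y lt" "f \<in> fin_supp_funs Y"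
  shows "lift_aut \<sigma> f \<in> fin_supp_funs Y"
proof -
  have b: "bij \<sigma>" using assms(1) by (simp add: order_auts_def)
  have "{x. lift_aut \<sigma> f x \<noteq> 0} \<subseteq> \<sigma> ` {x. f x \<noteq> 0}"
  proof
    fix x assume "x \<in> {x. lift_aut \<sigma> f x \<noteq> 0}"
    then show "x \<in> \<sigma> ` {x. f x \<noteq> 0}"
      using b by (intro image_eqI[of _ _ "inv_into UNIV \<sigma> x"]) (auto simp: lift_aut_def bij_is_surj surj_f_inv_f)
  qed
  moreover have "\<sigma> ` {x. f x \<noteq> 0} \<subseteq> Y"
    using assms order_auts_closed[OF assms(1)] by (auto simp: fin_supp_funs_def)
  ultimately show ?thesis
    using assms(2) finite_subset[OF _ finite_imageI, of _ \<sigma> "{x. f x \<noteq> 0}"]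
    unfolding fin_supp_funs_def by blast
qed

lemma lift_aut_order_auts:
  assumes "\<sigma> \<in> order_auts Y lt"
  shows "lift_aut \<sigma> \<in> order_auts (fin_supp_funs Y) (lex_less Y lt)"
proof (rule order_autsI)
  have b: "bij \<sigma>" using assms by (simp add: order_auts_def)
  then show "lift_aut (inv_into UNIV \<sigma>) (lift_aut \<sigma> f) = f" "lift_aut \<sigma> (lift_aut (inv_into UNIV \<sigma>) f) = f" for f
    by (auto simp: lift_aut_def fun_eq_iff inv_inv_eq bij_is_inj bij_is_surj surj_f_inv_f)
qed (use assms inv_order_auts[OF assms] lift_aut_less lift_aut_fin_supp_funs in blast)+

definition basis_fun :: "'a \<Rightarrow> 'a \<Rightarrow> int" where
  "basis_fun y = (\<lambda>x. if x = y then 1 else 0)"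

lemma basis_fun_inject [simp]: "basis_fun x = basis_fun y \<longleftrightarrow> x = y"
  by (auto simp: basis_fun_def fun_eq_iff)

lemma basis_fun_fin_supp_funs: "y \<in> Y \<Longrightarrow> basis_fun y \<in> fin_supp_funs Y"
  by (simp add: basis_fun_def fin_supp_funs_def)

lemma lift_aut_basis_fun: "bij \<sigma> \<Longrightarrow> lift_aut \<sigma> (basis_fun y) = basis_fun (\<sigma> y)"
  by (auto simp: lift_aut_def basis_fun_def fun_eq_iff bij_is_inj bij_is_surj surj_f_inv_f)

text \<open>Together with \<open>lift_aut_basis_fun\<close> this makes \<open>basis_fun\<close> an
  equivariant order embedding of \<open>Y\<close> into its function space.\<close>

lemma lex_less_basis_fun:
  assumes "strict_linear_on Y lt" "x \<in> Y" "y \<in> Y"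
  shows "lex_less Y lt (basis_fun x) (basis_fun y) \<longleftrightarrow> lt x y"
proof -
  note lin = strict_linear_onD[OF assms(1)]
  have "lex_less Y lt (basis_fun x) (basis_fun y) \<and> \<not> lex_less Y lt (basis_fun y) (basis_fun x)"
    if "x \<in> Y" "y \<in> Y" "lt x y" for x y
  proof -
    have "lex_less Y lt (basis_fun x) (basis_fun y)"
      using that lin(1)[of x] lin(1)[of y] lin(2)[of x y x]
      unfolding lex_less_def basis_fun_def by (intro bexI[of _ y]) auto
    moreover from this have "\<not> lex_less Y lt (basis_fun y) (basis_fun x)"
      using strict_linear_onD(1,2)[OF strict_linear_on_lex_less[OF assms(1)]]
        basis_fun_fin_supp_funs[OF that(1)] basis_fun_fin_supp_funs[OF that(2)] by blast
    ultimately show ?thesis ..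
  qed
  moreover have "\<not> lex_less Y lt (basis_fun x) (basis_fun x)"
    by (simp add: lex_less_def)
  ultimately show ?thesis
    using assms(2,3) lin(1)[of x] lin(3)[of x y] by blast
qed

section \<open>Translations and automorphisms glued at a point\<close>

lemma translation_order_auts:
  assumes "a \<in> fin_supp_funs Y"
  shows "(+) a \<in> order_auts (fin_supp_funs Y) (lex_less Y lt)"
proof (rule order_autsI[of "(+) (- a)"])
qed (use assms in \<open>simp_all add: fin_supp_funs_add fin_supp_funs_diff\<close>)

text \<open>The inner function space is an ordered group, so its elements can be shifted; shifting
  arguments gives automorphisms of the outer space that fix 0. Recentred at \<open>p\<close>, such a
  shift preserves the half-line above \<open>p\<close> and glues with the identity elsewhere. A
  large enough shift carries the leading difference of \<open>c\<close> and \<open>p\<close> beyond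
  all differences of \<open>d\<close> and \<open>p\<close>.\<close>

lemma push_up_aut:
  fixes X :: "'x set"
  defines "Y \<equiv> fin_supp_funs X" and "Z \<equiv> fin_supp_funs (fin_supp_funs X)"
  assumes X: "strict_linear_on X lt" "x0 \<in> X"
  defines "less1 \<equiv> lex_less X lt"
  defines "less2 \<equiv> lex_less Y less1"
  assumes pcd: "p \<in> Z" "c \<in> Z" "d \<in> Z" "less2 p c"
  obtains \<phi> where "\<phi> \<in> order_auts Z less2" "\<And>y. \<not> less2 p y \<Longrightarrow> \<phi> y = y" "less2 d (\<phi> c)"
proof -
  have Z: "Z = fin_supp_funs Y" by (simp add: Z_def Y_def)
  have lin1: "strict_linear_on Y less1"
    unfolding Y_def less1_def by (rule strict_linear_on_lex_less[OF X(1)])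
  have lin2: "strict_linear_on Z less2"
    unfolding Z less2_def by (rule strict_linear_on_lex_less[OF lin1])
  obtain b where b: "b \<in> Y" "p b < c b" "\<forall>z\<in>Y. less1 b z \<longrightarrow> p z = c z"
    using pcd(4) unfolding less2_def lex_less_def by blast
  \<comment> \<open>Inserting 0 keeps the set non-empty when \<open>d = p\<close>, so that a maximum
    exists.\<close>
  define D where "D = insert 0 {z. (d - p) z \<noteq> 0}"
  have "finite D" "D \<noteq> {}" "D \<subseteq> Y"
    using fin_supp_funs_diff[of d Y p] pcd unfolding Z D_def
    by (auto simp: fin_supp_funs_def Y_def)
  then obtain m where m: "m \<in> D" "\<And>z. z \<in> D \<Longrightarrow> z = m \<or> less1 z m"
    using strict_linear_on_finite_max[OF lin1] by metis
  have mY: "m \<in> Y" using m \<open>D \<subseteq> Y\<close> by blast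
  \<comment> \<open>Since \<open>basis_fun x0\<close> is positive, \<open>t\<close> lies strictly
    above \<open>D\<close>. The shift \<open>a\<close> takes the deciding position \<open>b\<close>
    of \<open>p\<close> and \<open>c\<close> to \<open>t\<close>.\<close>
  define t where "t = m + basis_fun x0"
  define a where "a = t - b"
  have tY: "t \<in> Y" and aY: "a \<in> Y"
    using mY b X(2) unfolding t_def a_def Y_def
    by (auto intro!: fin_supp_funs_add fin_supp_funs_diff basis_fun_fin_supp_funs)
  have "less1 0 (basis_fun x0)"
    unfolding less1_def lex_less_def basis_fun_def
    using X strict_linear_onD(1)[OF X(1)] by (intro bexI[of _ x0]) auto
  then have mt: "less1 m t"
    using lex_less_add[of X lt m 0 "basis_fun x0"] by (simp add: t_def less1_def)
  have Dt: "less1 z t" if "z \<in> D" for z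
    using m(2)[OF that] mt strict_linear_onD(2)[OF lin1, of z m t] that \<open>D \<subseteq> Y\<close> mY tY by blast
  define push where "push a = lift_aut ((+) (a :: 'x \<Rightarrow> int))" for a
  have trans: "(+) a \<in> order_auts Y less1" if "a \<in> Y" for a
    using that translation_order_auts unfolding Y_def less1_def by blast
  have push_apply: "push a f z = f (z - a)" for a f z
  proof -
    have "inv_into UNIV ((+) a) z = z - a" by (rule inv_f_eq) auto
    then show ?thesis by (simp add: push_def lift_aut_def)
  qed
  have push_less: "less2 (push a f) (push a g)" if "a \<in> Y" "less2 f g" for a f g
    using lift_aut_less[OF trans[OF that(1)]] that(2) unfolding push_def less2_def by blast
  have push_Z: "push a f \<in> Z" if "a \<in> Y" "f \<in> Z" for a f
    using lift_aut_fin_supp_funs[OF trans[OF that(1)]] that(2) unfolding push_def Z by blast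
  \<comment> \<open>Kept general in the shift because \<open>\<psi> (- a)\<close> will be the
    inverse of \<open>\<psi> a\<close>.\<close>
  define \<psi> where "\<psi> a y = (if less2 p y then p + push a (y - p) else y)" for a y
  \<comment> \<open>Points above \<open>p\<close> stay above \<open>p\<close>. This makes the two
    branches disjoint, hence \<open>\<psi>\<close> invertible, and monotone across the
    junction.\<close>
  have pos: "less2 p (p + push a (y - p))" if "a \<in> Y" "less2 p y" for a y
  proof -
    have "less2 0 (y - p)" using that(2) by (simp add: less2_def lex_less_diff)
    then have "less2 (push a 0) (push a (y - p))" by (rule push_less[OF that(1)])
    moreover have "push a 0 = 0" by (simp add: fun_eq_iff push_apply)
    ultimately have "less2 0 (push a (y - p))" by simp
    then show ?thesis using lex_less_add[of Y less1 p 0] by (simp add: less2_def)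
  qed
  have inverse: "\<psi> (- a) (\<psi> a y) = y" if "a \<in> Y" for a y
  proof (cases "less2 p y")
    case True
    with pos[OF that True] show ?thesis by (simp add: \<psi>_def fun_eq_iff push_apply)
  qed (simp add: \<psi>_def)
  have \<psi>Z: "\<psi> a y \<in> Z" if "a \<in> Y" "y \<in> Z" for a y
    using that pcd push_Z[OF that(1)] by (auto simp: \<psi>_def Z intro!: fin_supp_funs_add fin_supp_funs_diff)
  have \<psi>_less: "less2 (\<psi> a y) (\<psi> a z)" if h: "a \<in> Y" "y \<in> Z" "z \<in> Z" "less2 y z" for a y z
  proof -
    consider "less2 p y" "less2 p z" | "\<not> less2 p y" "less2 p z" | "\<not> less2 p y" "\<not> less2 p z"
      using strict_linear_onD(2)[OF lin2 pcd(1), of y z] h by blast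
    then show ?thesis
    proof cases
      case 1
      have "less2 (y - p) (z - p)"
        using lex_less_add[of Y less1 p "y - p" "z - p"] h(4) by (simp add: less2_def)
      from push_less[OF h(1) this] show ?thesis using 1 by (simp add: \<psi>_def less2_def)
    next
      case 2
      then have "y = p \<or> less2 y p" using strict_linear_onD(3)[OF lin2 pcd(1)] h by blast
      moreover have "p + push a (z - p) \<in> Z" using \<psi>Z[OF h(1,3)] 2 by (simp add: \<psi>_def)
      ultimately have "less2 y (p + push a (z - p))"
        using pos[OF h(1) 2(2)] strict_linear_onD(2)[OF lin2 h(2) pcd(1)] by blast
      then show ?thesis using 2 by (simp add: \<psi>_def)
    qed (use h in \<open>simp add: \<psi>_def\<close>)
  qed
  have maY: "- a \<in> Y" using aY unfolding Y_def by (rule fin_supp_funs_minus)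
  have "\<psi> a \<in> order_auts Z less2"
    by (rule order_autsI[of "\<psi> (- a)"])
      (use inverse[OF aY] inverse[OF maY] \<psi>Z[OF aY] \<psi>Z[OF maY] \<psi>_less[OF aY] \<psi>_less[OF maY] in auto)
  moreover have "\<psi> a y = y" if "\<not> less2 p y" for y using that by (simp add: \<psi>_def)
  \<comment> \<open>At \<open>t\<close> the image of \<open>c\<close> has the value
    \<open>p t + (c b - p b)\<close>, which exceeds \<open>p t = d t\<close>; at positions above
    \<open>t\<close> both the image and \<open>d\<close> agree with \<open>p\<close>.\<close>
  moreover have "less2 d (\<psi> a c)"
  proof -
    have vanish: "d z = p z" if "z = t \<or> less1 t z" "z \<in> Y" for z
    proof (rule ccontr)
      assume "d z \<noteq> p z"
      then have "less1 z t" by (intro Dt) (simp add: D_def)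
      then show False
        using that strict_linear_onD(1)[OF lin1] strict_linear_onD(2)[OF lin1, of t z t] tY by blast
    qed
    have "c (z - a) = p (z - a)" if "z \<in> Y" "less1 t z" for z
    proof -
      have "less1 b (z - a)"
        using lex_less_add[of X lt a b "z - a"] that(2) by (simp add: less1_def a_def)
      moreover have "z - a \<in> Y" using that aY unfolding Y_def by (auto intro: fin_supp_funs_diff)
      ultimately show ?thesis using b by auto
    qed
    then have "\<forall>z\<in>Y. less1 t z \<longrightarrow> d z = (p + push a (c - p)) z"
      using vanish by (simp add: push_apply)
    moreover have "t - a = b" by (simp add: a_def)
    then have "d t < (p + push a (c - p)) t"
      using vanish[of t] tY b(2) by (simp add: push_apply)
    ultimately have "less2 d (p + push a (c - p))"
      unfolding less2_def lex_less_def using tY by blast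
    then show ?thesis using pcd(4) by (simp add: \<psi>_def)
  qed
  ultimately show thesis by (rule that)
qed

section \<open>Left-preorders from order-preserving actions\<close>

locale preordered_group = group G for G (structure) +
  fixes R C
  assumes rel: "left_preorder_rel G C R"
begin

lemma R_carrier: "(x, y) \<in> R \<Longrightarrow> x \<in> carrier G \<and> y \<in> carrier G"
  using rel unfolding left_preorder_rel_def left_preorder_def preorder_on_def by blast

lemma R_refl: "x \<in> carrier G \<Longrightarrow> (x, x) \<in> R"
  using rel unfolding left_preorder_rel_def left_preorder_def preorder_on_def refl_on_def by blast

lemma R_trans: "(x, y) \<in> R \<Longrightarrow> (y, z) \<in> R \<Longrightarrow> (x, z) \<in> R"
proof -
  have "trans R" using rel by (simp add: left_preorder_rel_def left_preorder_def preorder_on_def)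
  then show "(x, y) \<in> R \<Longrightarrow> (y, z) \<in> R \<Longrightarrow> (x, z) \<in> R" by (rule transD)
qed

lemma R_total: "x \<in> carrier G \<Longrightarrow> y \<in> carrier G \<Longrightarrow> (x, y) \<in> R \<or> (y, x) \<in> R"
proof -
  have "total_on (carrier G) R" using rel by (simp add: left_preorder_rel_def left_preorder_def)
  then show "x \<in> carrier G \<Longrightarrow> y \<in> carrier G \<Longrightarrow> (x, y) \<in> R \<or> (y, x) \<in> R"
    using R_refl[of x] by (cases "x = y") (auto simp: total_on_def)
qed

lemma R_mult: "g \<in> carrier G \<Longrightarrow> (x, y) \<in> R \<Longrightarrow> (g \<otimes> x, g \<otimes> y) \<in> R"
  using rel R_carrier[of x y] by (simp add: left_preorder_rel_def left_preorder_def)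

lemma R_mult_iff:
  assumes "g \<in> carrier G" "x \<in> carrier G" "y \<in> carrier G"
  shows "(g \<otimes> x, g \<otimes> y) \<in> R \<longleftrightarrow> (x, y) \<in> R"
proof
  assume "(g \<otimes> x, g \<otimes> y) \<in> R"
  then have "(inv g \<otimes> (g \<otimes> x), inv g \<otimes> (g \<otimes> y)) \<in> R" using assms by (simp add: R_mult)
  then show "(x, y) \<in> R" using assms by (simp add: m_assoc[symmetric])
qed (use assms R_mult in blast)

lemma core_iff: "c \<in> C \<longleftrightarrow> c \<in> carrier G \<and> (c, \<one>) \<in> R \<and> (\<one>, c) \<in> R"
  using rel unfolding left_preorder_rel_def preorder_core_def by blast

text \<open>Translating by \<open>inv a\<close> turns equivalence of \<open>a\<close> and
  \<open>b\<close> into equivalence of \<open>\<one>\<close> and \<open>inv a \<otimes> b\<close>.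
  The classes of the preorder are therefore the left cosets of \<open>C\<close>.\<close>

lemma inv_core_iff:
  assumes "a \<in> carrier G" "b \<in> carrier G"
  shows "inv a \<otimes> b \<in> C \<longleftrightarrow> (a, b) \<in> R \<and> (b, a) \<in> R"
  using assms R_mult_iff[of "inv a" a b] R_mult_iff[of "inv a" b a] by (auto simp: core_iff)

text \<open>Non-triviality yields some \<open>x\<close> strictly above some \<open>y\<close>; left
  translation moves \<open>y\<close> to \<open>m\<close> and \<open>x\<close> to an element strictly
  above it.\<close>

lemma no_greatest:
  assumes "m \<in> carrier G"
  obtains u where "u \<in> carrier G" "(u, m) \<notin> R"
proof -
  obtain x y where xy: "x \<in> carrier G" "y \<in> carrier G" "(x, y) \<notin> R"
  proof -
    have "R \<noteq> carrier G \<times> carrier G" using rel by (simp add: left_preorder_rel_def left_preorder_def)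
    moreover have "R \<subseteq> carrier G \<times> carrier G" using R_carrier by auto
    ultimately show thesis using that by auto
  qed
  define g where "g = m \<otimes> inv y"
  have "g \<in> carrier G" "g \<otimes> y = m" using xy assms by (simp_all add: g_def m_assoc)
  then have "(g \<otimes> x, m) \<notin> R" using R_mult_iff[of g x y] xy by simp
  then show thesis using that[of "g \<otimes> x"] \<open>g \<in> carrier G\<close> xy by simp
qed

lemma finite_greatest:
  assumes "finite E" "E \<noteq> {}" "E \<subseteq> carrier G"
  obtains m where "m \<in> E" "\<And>e. e \<in> E \<Longrightarrow> (e, m) \<in> R"
proof -
  have "asymp_on E (\<lambda>x y. (y, x) \<notin> R)"
  proof (rule asymp_onI)
    show "\<not> (x, y) \<notin> R" if "x \<in> E" "y \<in> E" "(y, x) \<notin> R" for x y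
      using R_total[of x y] that assms(3) by blast
  qed
  moreover have "transp_on E (\<lambda>x y. (y, x) \<notin> R)"
  proof (rule transp_onI)
    fix x y z assume "x \<in> E" "y \<in> E" "z \<in> E" "(y, x) \<notin> R" "(z, y) \<notin> R"
    then show "(z, x) \<notin> R" using R_total[of x y] R_trans[of z x y] assms(3) by blast
  qed
  ultimately obtain m where m: "m \<in> E" "\<forall>x\<in>E. x \<noteq> m \<longrightarrow> (x, m) \<in> R"
    using Finite_Set.bex_max_element[OF assms(1) _ _ assms(2)] by blast
  have "(e, m) \<in> R" if "e \<in> E" for e
    using m(2) that R_refl[of m] m(1) assms(3) by (cases "e = m") auto
  with m(1) show thesis by (rule that)
qed

lemma infinite_carrier: "infinite (carrier G)"
proof
  assume "finite (carrier G)"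
  then obtain m where "m \<in> carrier G" "\<And>e. e \<in> carrier G \<Longrightarrow> (e, m) \<in> R"
    using finite_greatest[of "carrier G"] by blast
  then show False using no_greatest by blast
qed

end

section \<open>Preorders induced by actions\<close>

lemma hom_perm_group:
  assumes "group G" "group (perm_group S)" "F \<in> hom G (perm_group S)"
  shows "a \<in> carrier G \<Longrightarrow> b \<in> carrier G \<Longrightarrow> F (a \<otimes>\<^bsub>G\<^esub> b) y = F a (F b y)"
    and "F \<one>\<^bsub>G\<^esub> y = y" and "a \<in> carrier G \<Longrightarrow> F (inv\<^bsub>G\<^esub> a) (F a y) = y"
    and "a \<in> carrier G \<Longrightarrow> F a \<in> S"
proof -
  interpret group G by (rule assms)
  show m: "F (a \<otimes>\<^bsub>G\<^esub> b) y = F a (F b y)" if "a \<in> carrier G" "b \<in> carrier G" for a b y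
    using hom_mult[OF assms(3) that] by simp
  show o: "F \<one>\<^bsub>G\<^esub> y = y" for y
    using hom_one[OF assms(3,1,2)] by simp
  show "F (inv\<^bsub>G\<^esub> a) (F a y) = y" if "a \<in> carrier G"
    using m[of "inv\<^bsub>G\<^esub> a" a y] o that by simp
  show "F a \<in> S" if "a \<in> carrier G" using assms(3) that by (auto simp: hom_def)
qed

text \<open>Ties between orbit points are broken by the given preorder.\<close>

definition action_preorder ::
    "('g, 'm) monoid_scheme \<Rightarrow> 'g rel \<Rightarrow> ('o \<Rightarrow> 'o \<Rightarrow> bool) \<Rightarrow> ('g \<Rightarrow> 'o \<Rightarrow> 'o) \<Rightarrow> 'o \<Rightarrow> 'g rel" where
  "action_preorder G R lt F y0 = {(a, b). a \<in> carrier G \<and> b \<in> carrier G \<and>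
     (lt (F a y0) (F b y0) \<or> F a y0 = F b y0 \<and> (a, b) \<in> R)}"

text \<open>Left invariance holds because both the action and \<open>R\<close> respect left
  multiplication. The core is exactly \<open>C\<close>: an element whose orbit point is tied with
  \<open>y0\<close> is still compared with \<open>\<one>\<close> by \<open>R\<close>, while elements
  of \<open>C\<close> are tied in both respects.\<close>

lemma (in preordered_group) action_preorder_rel:
  assumes lin: "strict_linear_on Y lt" and F: "F \<in> hom G (perm_group (order_auts Y lt))"
    and y0: "y0 \<in> Y" and fix_C: "\<And>c. c \<in> C \<Longrightarrow> F c y0 = y0"
  shows "left_preorder_rel G C (action_preorder G R lt F y0)"
proof -
  let ?R = "action_preorder G R lt F y0"
  note hom = hom_perm_group[OF is_group group_order_auts F]
  note lin = strict_linear_onD[OF lin]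
  have Y: "F a y \<in> Y" if "a \<in> carrier G" "y \<in> Y" for a y
    using order_auts_closed[OF hom(4)] that by blast
  have "refl_on (carrier G) ?R"
    by (auto simp: refl_on_def action_preorder_def R_refl)
  moreover have "trans ?R"
  proof (rule transI)
    fix a b c assume ab: "(a, b) \<in> ?R" and bc: "(b, c) \<in> ?R"
    then have "a \<in> carrier G" "b \<in> carrier G" "c \<in> carrier G" by (auto simp: action_preorder_def)
    then show "(a, c) \<in> ?R"
      using ab bc lin(2)[OF Y[OF _ y0] Y[OF _ y0] Y[OF _ y0], of a b c] R_trans[of a b c]
      unfolding action_preorder_def by auto
  qed
  moreover have "total_on (carrier G) ?R"
    unfolding total_on_def action_preorder_def
    using lin(3)[OF Y[OF _ y0] Y[OF _ y0]] R_total by auto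
  moreover have "(g \<otimes> a, g \<otimes> b) \<in> ?R" if g: "g \<in> carrier G" and "(a, b) \<in> ?R" for g a b
  proof -
    have ab: "a \<in> carrier G" "b \<in> carrier G"
      and "lt (F a y0) (F b y0) \<or> F a y0 = F b y0 \<and> (a, b) \<in> R"
      using that by (auto simp: action_preorder_def)
    then show ?thesis
      using g order_auts_less_iff[OF hom(4)[OF g] Y[OF ab(1) y0] Y[OF ab(2) y0]] R_mult[OF g]
      by (auto simp: action_preorder_def hom(1))
  qed
  moreover have core: "preorder_core G ?R = C"
  proof
    show "preorder_core G ?R \<subseteq> C"
      using lin(1) lin(2)[OF y0 _ y0] y0 Y
      by (auto simp: preorder_core_def action_preorder_def hom(2) core_iff)
    show "C \<subseteq> preorder_core G ?R"
      using fix_C by (auto simp: preorder_core_def action_preorder_def hom(2) core_iff)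
  qed
  moreover have "?R \<noteq> carrier G \<times> carrier G"
  proof
    assume "?R = carrier G \<times> carrier G"
    then have "carrier G \<subseteq> C" using core by (auto simp: preorder_core_def)
    moreover obtain u where "u \<in> carrier G" "(u, \<one>) \<notin> R" using no_greatest[OF one_closed] .
    ultimately show False by (auto simp: core_iff)
  qed
  moreover have "?R \<subseteq> carrier G \<times> carrier G" by (auto simp: action_preorder_def)
  ultimately show ?thesis
    unfolding left_preorder_rel_def left_preorder_def preorder_on_def by blast
qed

section \<open>Twisting an action on one factor\<close>

text \<open>The consequence of the universal property of a free product that the argument needs: an
  action may be kept on one factor and conjugated on the other. The set \<open>S\<close> varies
  because both order automorphisms and arbitrary permutations occur as conjugators;
  \<open>\<psi>\<close> is the inverse of \<open>\<phi>\<close>.\<close>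

definition twistable ::
    "'o itself \<Rightarrow> ('g, 'm) monoid_scheme \<Rightarrow> 'g set \<Rightarrow> 'g set \<Rightarrow> bool" where
  "twistable TYPE('o) G A B \<longleftrightarrow> (\<forall>(S :: ('o \<Rightarrow> 'o) set) F. \<forall>\<phi>\<in>S. \<forall>\<psi>\<in>S.
     group (perm_group S) \<longrightarrow> F \<in> hom G (perm_group S) \<longrightarrow> \<phi> \<circ> \<psi> = id \<longrightarrow> \<psi> \<circ> \<phi> = id \<longrightarrow>
     (\<exists>F'\<in>hom G (perm_group S). (\<forall>a\<in>A. F' a = F a) \<and> (\<forall>b\<in>B. F' b = \<phi> \<circ> F b \<circ> \<psi>)))"

abbreviation word_value :: "('g, 'm) monoid_scheme \<Rightarrow> 'g list \<Rightarrow> 'g" where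
  "word_value G l \<equiv> foldr (\<otimes>\<^bsub>G\<^esub>) l \<one>\<^bsub>G\<^esub>"

text \<open>Letters of a word act from the right, so the suffixes are the prefixes of its
  trajectory: their values applied to a point are the intermediate positions.\<close>

definition suffix_closed_words :: "'g set \<Rightarrow> 'g list set \<Rightarrow> bool" where
  "suffix_closed_words A W \<longleftrightarrow> (\<forall>x l. x # l \<in> W \<longrightarrow> x \<in> A \<and> l \<in> W)"

lemma (in monoid) word_value_closed:
  assumes "suffix_closed_words A W" "A \<subseteq> carrier G" "l \<in> W"
  shows "word_value G l \<in> carrier G"
  using assms(3)
proof (induction l)
  case (Cons x l)
  then show ?case using assms(1,2) unfolding suffix_closed_words_def by auto
qed simp

text \<open>Every intermediate point is fixed by \<open>\<phi>\<close>, hence by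
  \<open>\<psi>\<close>. A conjugated letter thus acts on the trajectory as the original one does,
  and induction along suffixes gives the claim.\<close>

lemma twist_agrees:
  assumes G: "group G" and S: "group (perm_group S)"
    and F: "F \<in> hom G (perm_group S)" and F': "F' \<in> hom G (perm_group S)"
    and F'A: "\<And>a. a \<in> A \<Longrightarrow> F' a = F a" and F'B: "\<And>b. b \<in> B \<Longrightarrow> F' b = \<phi> \<circ> F b \<circ> \<psi>"
    and inverse: "\<psi> \<circ> \<phi> = id"
    and W: "suffix_closed_words (A \<union> B) W" "A \<union> B \<subseteq> carrier G"
    and fixed: "\<And>l. l \<in> W \<Longrightarrow> \<phi> (F (word_value G l) y) = F (word_value G l) y"
    and l: "l \<in> W"
  shows "F' (word_value G l) y = F (word_value G l) y"
  using l
proof (induction l)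
  case Nil
  then show ?case
    using hom_perm_group(2)[OF G S F] hom_perm_group(2)[OF G S F'] by simp
next
  case (Cons x l)
  interpret group G by (rule G)
  have x: "x \<in> A \<union> B" and l: "l \<in> W" using W(1) Cons.prems by (auto simp: suffix_closed_words_def)
  let ?z = "F (word_value G l) y"
  have closed: "x \<in> carrier G" "word_value G l \<in> carrier G"
    using x W word_value_closed[OF W l] by auto
  have "\<psi> ?z = ?z" using fixed[OF l] inverse by (metis comp_apply id_apply)
  moreover have "\<phi> (F x ?z) = F x ?z"
    using fixed[OF Cons.prems] hom_perm_group(1)[OF G S F closed] by simp
  ultimately have "F' x ?z = F x ?z" using x F'A F'B by auto
  then show ?case
    using Cons.IH[OF l] hom_perm_group(1)[OF G S F closed] hom_perm_group(1)[OF G S F' closed] by simp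
qed

text \<open>A dynamical realisation of \<open>R\<close>: the orbit of \<open>y0\<close>, with the
  order of \<open>Y\<close>, is the group modulo the equivalence of \<open>R\<close>.\<close>

locale order_action = preordered_group G R C for G (structure) and R C +
  fixes Y :: "'o set" and lt F y0
  assumes lin: "strict_linear_on Y lt" and F: "F \<in> hom G (perm_group (order_auts Y lt))"
    and y0: "y0 \<in> Y"
    and lt_iff: "\<And>a b. a \<in> carrier G \<Longrightarrow> b \<in> carrier G \<Longrightarrow> lt (F a y0) (F b y0) \<longleftrightarrow> (b, a) \<notin> R"
begin

lemmas F_hom = hom_perm_group[OF is_group group_order_auts F]

lemma F_closed: "a \<in> carrier G \<Longrightarrow> y \<in> Y \<Longrightarrow> F a y \<in> Y"
  using order_auts_closed[OF F_hom(4)] by blast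

lemma orbit_eq_iff:
  assumes "a \<in> carrier G" "b \<in> carrier G"
  shows "F a y0 = F b y0 \<longleftrightarrow> (a, b) \<in> R \<and> (b, a) \<in> R"
proof
  assume "F a y0 = F b y0"
  then show "(a, b) \<in> R \<and> (b, a) \<in> R"
    using assms lt_iff[of a b] lt_iff[of b a] strict_linear_onD(1)[OF lin F_closed[OF assms(1) y0]] by simp
next
  assume "(a, b) \<in> R \<and> (b, a) \<in> R"
  then show "F a y0 = F b y0"
    using assms lt_iff strict_linear_onD(3)[OF lin F_closed[OF assms(1) y0] F_closed[OF assms(2) y0]] by blast
qed

text \<open>Fixing \<open>y0\<close> passes to products and inverses, so the generators suffice. The
  group \<open>S\<close> may be larger than the order automorphisms, which admits twists by a
  transposition.\<close>

lemma twist_fixes_core: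
  assumes S: "group (perm_group S)" "order_auts Y lt \<subseteq> S" and F': "F' \<in> hom G (perm_group S)"
    and gens: "C = generate G T" "\<And>t. t \<in> T \<Longrightarrow> F' t y0 = F t y0"
    and c: "c \<in> C"
  shows "F' c y0 = y0"
proof -
  note hom' = hom_perm_group[OF is_group S(1) F']
  have T: "T \<subseteq> C" using generate.incl[of _ T G] gens(1) by blast
  have carr: "C \<subseteq> carrier G" by (auto simp: core_iff)
  have fix_T: "F' t y0 = y0" if "t \<in> T" for t
  proof -
    have "F t y0 = F \<one> y0" using orbit_eq_iff[of t \<one>] T that core_iff[of t] by auto
    then show ?thesis using gens(2)[OF that] F_hom(2) by simp
  qed
  have "c \<in> generate G T" using c gens(1) by simp
  then show ?thesis
  proof (induction rule: generate.induct)
    case one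
    then show ?case by (rule hom'(2))
  next
    case (incl t)
    then show ?case by (rule fix_T)
  next
    case (inv t)
    then have "t \<in> carrier G" using T carr by blast
    then show ?case using hom'(3)[of t y0] fix_T[OF inv] by simp
  next
    case (eng a b)
    then have "a \<in> carrier G" "b \<in> carrier G" using carr gens(1) by blast+
    then show ?case using hom'(1)[of a b y0] eng by simp
  qed
qed

text \<open>The factor \<open>A\<close> contains the element that leads above all prescribed points
  and keeps its action; the action of \<open>B\<close> is conjugated above that level. The roles of
  the factors differ, so both assignments are needed later.\<close>

lemma exists_other_preorder:
  assumes AB: "A \<subseteq> carrier G" "B \<subseteq> carrier G" and inv_B: "\<And>b. b \<in> B \<Longrightarrow> inv b \<in> B"
    and tw: "twistable TYPE('o) G A B"
    and push: "\<And>p c d. p \<in> Y \<Longrightarrow> c \<in> Y \<Longrightarrow> d \<in> Y \<Longrightarrow> lt p c \<Longrightarrow>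
      \<exists>\<phi>\<in>order_auts Y lt. (\<forall>y. \<not> lt p y \<longrightarrow> \<phi> y = y) \<and> lt d (\<phi> c)"
    and free: "\<And>h. h \<in> carrier G \<Longrightarrow> h \<noteq> \<one> \<Longrightarrow> infinite {z. F h z \<noteq> z}"
    and W: "finite W" "suffix_closed_words (A \<union> B) W"
    and T: "C = generate G T" "T \<subseteq> word_value G ` W" and I: "I \<subseteq> word_value G ` W"
    and v: "v \<in> word_value G ` W" "\<And>e. e \<in> word_value G ` W \<Longrightarrow> (e, v) \<in> R"
    and g: "g \<in> A" "(g \<otimes> v, v) \<notin> R" and h: "h \<in> B" "h \<noteq> \<one>"
  shows "\<exists>R'. left_preorder_rel G C R' \<and> R' \<noteq> R \<and>
    (\<forall>w\<in>I. ((\<one>, w) \<in> R' \<longleftrightarrow> (\<one>, w) \<in> R) \<and> ((w, \<one>) \<in> R' \<longleftrightarrow> (w, \<one>) \<in> R))"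
proof -
  define E where "E = word_value G ` W"
  have ABc: "A \<union> B \<subseteq> carrier G" using AB by blast
  have E: "E \<subseteq> carrier G" using word_value_closed[OF W(2) ABc] by (auto simp: E_def)
  have gc: "g \<in> carrier G" and hc: "h \<in> carrier G" and vc: "v \<in> carrier G"
    using g h AB v(1) E by (auto simp: E_def)
  \<comment> \<open>The threshold: it lies strictly above every point whose position must be
    preserved.\<close>
  define p where "p = F (g \<otimes> v) y0"
  have gvc: "g \<otimes> v \<in> carrier G" using gc vc by simp
  have pY: "p \<in> Y" unfolding p_def by (rule F_closed[OF gvc y0])
  have F_e: "F e y0 \<in> Y" "lt (F e y0) p" if "e \<in> E" for e
  proof -
    show "F e y0 \<in> Y" using that E F_closed y0 by blast
    have "(g \<otimes> v, e) \<notin> R" using R_trans[of "g \<otimes> v" e v] v(2) that g(2) by (auto simp: E_def)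
    then show "lt (F e y0) p" using lt_iff[of e "g \<otimes> v"] that E gvc by (auto simp: p_def)
  qed
  note linD = strict_linear_onD[OF lin]

  text \<open>If \<open>h\<close> fixed \<open>p\<close>, a conjugate of \<open>h\<close> would lie in \<open>C\<close>; but exchanging \<open>p\<close> with a point
    moved by \<open>h\<close> twists the action without affecting the generators of \<open>C\<close>.\<close>
  have moved: "F h p \<noteq> p"
  proof
    assume hp: "F h p = p"
    \<comment> \<open>All permutations: the order plays no part while only the stabiliser of
      \<open>y0\<close> is examined.\<close>
    define S where "S = order_auts UNIV (\<lambda>(_::'o) (_::'o). False)"
    have S: "group (perm_group S)" "order_auts Y lt \<subseteq> S"
      unfolding S_def by (rule group_order_auts) (auto simp: order_auts_def bij_is_surj)
    have FS: "F \<in> hom G (perm_group S)"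
      using F S(2) by (auto simp: hom_def)
    \<comment> \<open>Infinitely many points are moved by \<open>h\<close>, so one of them avoids
      \<open>p\<close> and the finitely many prescribed points.\<close>
    have "finite (insert p ((\<lambda>e. F e y0) ` E))" using W(1) by (simp add: E_def)
    from Diff_infinite_finite[OF this free[OF hc h(2)]]
    obtain z where "z \<in> {z. F h z \<noteq> z} - insert p ((\<lambda>e. F e y0) ` E)"
      using infinite_imp_nonempty by blast
    then have z: "F h z \<noteq> z" "z \<noteq> p" "\<And>e. e \<in> E \<Longrightarrow> F e y0 \<noteq> z"
      by auto
    define \<tau> where "\<tau> = transpose p z"
    have \<tau>: "\<tau> \<in> S" "\<tau> \<circ> \<tau> = id"
      by (simp_all add: S_def \<tau>_def order_auts_def bij_is_surj)
    obtain F' where F': "F' \<in> hom G (perm_group S)" "\<And>a. a \<in> A \<Longrightarrow> F' a = F a"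
        "\<And>b. b \<in> B \<Longrightarrow> F' b = \<tau> \<circ> F b \<circ> \<tau>"
      using tw[unfolded twistable_def, rule_format, OF \<tau>(1,1) S(1) FS \<tau>(2,2)] by blast
    have "\<tau> (F e y0) = F e y0" if "e \<in> E" for e
      using F_e[OF that] linD(1)[OF pY] z(3)[OF that] by (intro transpose_apply_other[of _ p z, folded \<tau>_def]) auto
    then have agree: "F' e y0 = F e y0" if "e \<in> E" for e
      using twist_agrees[OF is_group S(1) FS F' \<tau>(2) W(2) ABc, of y0] that by (auto simp: E_def)
    note hom' = hom_perm_group[OF is_group S(1) F'(1)]
    \<comment> \<open>The twist leaves the position of \<open>v\<close> and the action of
      \<open>g\<close> unchanged, so \<open>p\<close> is still reached from
      \<open>y0\<close>.\<close>
    have F'p: "F' (g \<otimes> v) y0 = p"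
      using agree[of v] v(1) F'(2)[OF g(1)] F_hom(1)[OF gc vc] hom'(1)[OF gc vc]
      by (simp add: E_def p_def)
    \<comment> \<open>If \<open>h\<close> fixes \<open>p\<close>, this conjugate lies in
      \<open>C\<close>; the twisted action of \<open>C\<close> fixes \<open>y0\<close>, so the
      twisted \<open>h\<close> would fix \<open>p\<close> as well.\<close>
    define c where "c = inv (g \<otimes> v) \<otimes> (h \<otimes> (g \<otimes> v))"
    have cc: "c \<in> carrier G" using gvc hc by (simp add: c_def)
    have gvc_c: "(g \<otimes> v) \<otimes> c = h \<otimes> (g \<otimes> v)"
      using gvc hc by (simp add: c_def m_assoc[symmetric])
    have "F (h \<otimes> (g \<otimes> v)) y0 = F (g \<otimes> v) y0"
      using hp F_hom(1)[OF hc gvc] by (simp add: p_def)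
    then have "c \<in> C"
      using orbit_eq_iff[of "h \<otimes> (g \<otimes> v)" "g \<otimes> v"] inv_core_iff[of "g \<otimes> v" "h \<otimes> (g \<otimes> v)"] hc gvc
      by (simp add: c_def)
    moreover have "F' t y0 = F t y0" if "t \<in> T" for t
      using agree T(2) that unfolding E_def by blast
    ultimately have "F' c y0 = y0"
      using twist_fixes_core[OF S F'(1) T(1)] by blast
    then have "F' (h \<otimes> (g \<otimes> v)) y0 = p"
      using hom'(1)[OF gvc cc, of y0] F'p gvc_c by simp
    \<comment> \<open>As \<open>\<tau>\<close> exchanges \<open>p\<close> and \<open>z\<close>, this
      forces \<open>h\<close> to fix \<open>z\<close>, against its choice.\<close>
    then have "\<tau> (F h (\<tau> p)) = p"
      using hom'(1)[OF hc gvc] F'p F'(3)[OF h(1)] by simp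
    then have "F h z = z"
      by (metis \<tau>_def transpose_apply_first transpose_eq_iff)
    with z(1) show False ..
  qed
  \<comment> \<open>If \<open>h\<close> moves \<open>p\<close> down, its inverse moves
    \<open>p\<close> up.\<close>
  obtain k where k: "k \<in> B" "lt p (F k p)"
  proof (cases "lt p (F h p)")
    case False
    then have "lt (F h p) p" using linD(3)[OF pY F_closed[OF hc pY]] moved by metis
    then have "lt (F (inv h) (F h p)) (F (inv h) p)"
      using order_auts_less_iff[OF F_hom(4)] F_closed[OF hc pY] pY hc by simp
    then show thesis using that[of "inv h"] inv_B[OF h(1)] F_hom(3)[OF hc] by simp
  qed (use h that in blast)
  have kc: "k \<in> carrier G" using k(1) AB by blast
  \<comment> \<open>Both \<open>a\<close> and \<open>b\<close> step upward from \<open>p\<close>,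
    the former by a conjugated letter and the latter by an unconjugated one. The twist replaces the
    point of \<open>a\<close> by its image under \<open>\<phi>\<close> and leaves the point of
    \<open>b\<close> in place.\<close>
  define a where "a = k \<otimes> (g \<otimes> v)"
  define b where "b = g \<otimes> (g \<otimes> v)"
  have abc: "a \<in> carrier G" "b \<in> carrier G" using kc gc gvc by (simp_all add: a_def b_def)
  have Fa: "F a y0 = F k p" and Fb: "F b y0 = F g p"
    using F_hom(1)[OF kc gvc] F_hom(1)[OF gc gvc] by (simp_all add: a_def b_def p_def)
  have abY: "F a y0 \<in> Y" "F b y0 \<in> Y" using F_closed abc y0 by blast+
  have pa: "lt p (F a y0)" using k(2) Fa by simp
  have pb: "lt p (F b y0)"
    using lt_iff[OF gvc abc(2)] R_mult_iff[OF gc gvc vc] g(2) by (simp add: p_def b_def)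

  \<comment> \<open>Any automorphism trivial off the half-line above \<open>p\<close> that changes
    the truth of \<open>(b, a) \<in> R\<close> will do. The second alternative of
    \<open>swap\<close> includes a tie between \<open>a\<close> and \<open>b\<close>.\<close>
  have key: "?thesis" if \<phi>: "\<phi> \<in> order_auts Y lt" "\<psi> \<in> order_auts Y lt" "\<phi> \<circ> \<psi> = id" "\<psi> \<circ> \<phi> = id"
    and below: "\<And>y. \<not> lt p y \<Longrightarrow> \<phi> y = y"
    and swap: "lt (F b y0) (\<phi> (F a y0)) \<and> lt (F a y0) (F b y0) \<or>
      lt (\<phi> (F a y0)) (F b y0) \<and> \<not> lt (F a y0) (F b y0)" for \<phi> \<psi>
  proof -
    obtain F' where F': "F' \<in> hom G (perm_group (order_auts Y lt))" "\<And>a. a \<in> A \<Longrightarrow> F' a = F a"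
        "\<And>b. b \<in> B \<Longrightarrow> F' b = \<phi> \<circ> F b \<circ> \<psi>"
      using tw[unfolded twistable_def, rule_format, OF \<phi>(1,2) group_order_auts F \<phi>(3,4)] by blast
    have "\<phi> (F e y0) = F e y0" if "e \<in> E" for e
      using F_e[OF that] linD(1)[OF pY] linD(2)[OF pY _ pY] by (intro below) blast
    then have agree: "F' e y0 = F e y0" if "e \<in> E" for e
      using twist_agrees[OF is_group group_order_auts F F' \<phi>(4) W(2) ABc, of y0] that
      by (auto simp: E_def)
    note hom' = hom_perm_group[OF is_group group_order_auts F'(1)]
    have "F' t y0 = F t y0" if "t \<in> T" for t
      using agree T(2) that unfolding E_def by blast
    then have fix_C: "F' c y0 = y0" if "c \<in> C" for c
      using twist_fixes_core[OF group_order_auts order.refl F'(1) T(1) _ that] by blast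
    define R' where "R' = action_preorder G R lt F' y0"
    have "left_preorder_rel G C R'"
      unfolding R'_def by (rule action_preorder_rel[OF lin F'(1) y0 fix_C])
    moreover have "((\<one>, w) \<in> R' \<longleftrightarrow> (\<one>, w) \<in> R) \<and> ((w, \<one>) \<in> R' \<longleftrightarrow> (w, \<one>) \<in> R)" if "w \<in> I" for w
    proof -
      have w: "w \<in> carrier G" "F' w y0 = F w y0" "F' \<one> y0 = F \<one> y0"
        using that I E agree hom'(2) F_hom(2) by (auto simp: E_def)
      then show ?thesis
        using R_total[OF w(1) one_closed]
        by (auto simp: R'_def action_preorder_def lt_iff orbit_eq_iff)
    qed
    moreover have "R' \<noteq> R"
    proof -
      have F'p: "F' (g \<otimes> v) y0 = p"
        using agree[of v] v(1) F'(2)[OF g(1)] F_hom(1)[OF gc vc] hom'(1)[OF gc vc]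
        by (simp add: E_def p_def)
      have "\<phi> p = p" by (rule below) (rule linD(1)[OF pY])
      \<comment> \<open>Conjugation at a fixed point: the twisted \<open>k\<close> takes
        \<open>p\<close> to \<open>\<phi> (F k p)\<close>.\<close>
      then have "\<psi> p = p" using \<phi>(4) by (metis comp_apply id_apply)
      then have F'a: "F' a y0 = \<phi> (F a y0)"
        using hom'(1)[OF kc gvc] F'p F'(3)[OF k(1)] Fa by (simp add: a_def)
      have F'b: "F' b y0 = F b y0"
        using hom'(1)[OF gc gvc] F'p F'(2)[OF g(1)] Fb by (simp add: b_def)
      have "(b, a) \<in> R \<longleftrightarrow> \<not> lt (F a y0) (F b y0)" using lt_iff[OF abc] by blast
      moreover have "(b, a) \<in> R'" if "lt (F b y0) (\<phi> (F a y0))"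
        using that abc F'a F'b by (simp add: R'_def action_preorder_def)
      moreover have "(b, a) \<notin> R'" if "lt (\<phi> (F a y0)) (F b y0)"
      proof -
        have "\<phi> (F a y0) \<in> Y" using order_auts_closed[OF \<phi>(1) abY(1)] .
        then show ?thesis
          using that abY linD(1)[of "F b y0"] linD(2)[of "F b y0" "\<phi> (F a y0)" "F b y0"] F'a F'b
          by (auto simp: R'_def action_preorder_def)
      qed
      ultimately show ?thesis using swap by blast
    qed
    ultimately show ?thesis by blast
  qed
  have inverse: "\<phi> \<circ> inv_into UNIV \<phi> = id" "inv_into UNIV \<phi> \<circ> \<phi> = id" if "\<phi> \<in> order_auts Y lt" for \<phi>
    using that by (auto simp: order_auts_def bij_is_inj bij_is_surj surj_f_inv_f fun_eq_iff)
  show ?thesis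
  proof (cases "lt (F a y0) (F b y0)")
    case True
    obtain \<phi> where \<phi>: "\<phi> \<in> order_auts Y lt" "\<forall>y. \<not> lt p y \<longrightarrow> \<phi> y = y" "lt (F b y0) (\<phi> (F a y0))"
      using push[OF pY abY pa] by blast
    show ?thesis
      by (rule key[OF \<phi>(1) inv_order_auts[OF \<phi>(1)] inverse[OF \<phi>(1)]]) (use \<phi> True in blast)+
  next
    case False
    \<comment> \<open>Only upward pushes are available, so the point of \<open>b\<close> is pushed
      above that of \<open>a\<close>; the inverse then lowers the point of \<open>a\<close> below
      that of \<open>b\<close>.\<close>
    obtain \<phi> where \<phi>: "\<phi> \<in> order_auts Y lt" "\<forall>y. \<not> lt p y \<longrightarrow> \<phi> y = y" "lt (F a y0) (\<phi> (F b y0))"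
      using push[OF pY abY(2,1) pb] by blast
    let ?\<psi> = "inv_into UNIV \<phi>"
    note \<psi> = inv_order_auts[OF \<phi>(1)]
    have "?\<psi> y = y" if "\<not> lt p y" for y
      using that \<phi>(2) inverse(2)[OF \<phi>(1)] by (metis comp_apply id_apply)
    moreover have "lt (?\<psi> (F a y0)) (F b y0)"
    proof -
      have "lt (?\<psi> (F a y0)) (?\<psi> (\<phi> (F b y0)))"
        using order_auts_less_iff[OF \<psi> abY(1) order_auts_closed[OF \<phi>(1) abY(2)]] \<phi>(3) by simp
      then show ?thesis using inverse(2)[OF \<phi>(1)] by (metis comp_apply id_apply)
    qed
    ultimately show ?thesis
      using key[OF \<psi> \<phi>(1) inverse(2,1)[OF \<phi>(1)]] False by blast
  qed
qed

end

section \<open>The action on the cosets\<close>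

text \<open>Elements outside the carrier are left alone, so that each group element permutes all
  sets of the type, not only the cosets.\<close>

definition coset_action :: "('g, 'm) monoid_scheme \<Rightarrow> 'g \<Rightarrow> 'g set \<Rightarrow> 'g set" where
  "coset_action G w = (`) (\<lambda>x. if x \<in> carrier G then w \<otimes>\<^bsub>G\<^esub> x else x)"

definition coset_less :: "'g rel \<Rightarrow> 'g set \<Rightarrow> 'g set \<Rightarrow> bool" where
  "coset_less R A B \<longleftrightarrow> (\<exists>a\<in>A. \<exists>b\<in>B. (b, a) \<notin> R)"

context group
begin

lemma coset_action_mult:
  assumes "u \<in> carrier G" "w \<in> carrier G"
  shows "coset_action G (u \<otimes> w) = coset_action G u \<circ> coset_action G w"
proof
  fix A
  show "coset_action G (u \<otimes> w) A = (coset_action G u \<circ> coset_action G w) A"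
    unfolding coset_action_def comp_apply image_image
    by (rule image_cong) (use assms in \<open>auto simp: m_assoc\<close>)
qed

lemma coset_action_one: "coset_action G \<one> = id"
proof
  fix A
  have "(\<lambda>x. if x \<in> carrier G then \<one> \<otimes> x else x) ` A = (\<lambda>x. x) ` A"
    by (rule image_cong) auto
  then show "coset_action G \<one> A = id A" by (simp add: coset_action_def)
qed

lemma coset_action_inv:
  assumes "w \<in> carrier G"
  shows "coset_action G (inv w) (coset_action G w A) = A"
    and "coset_action G w (coset_action G (inv w) A) = A"
  using coset_action_mult[of "inv w" w] coset_action_mult[of w "inv w"] coset_action_one assms
  by (simp_all add: fun_eq_iff)

lemma coset_action_l_coset:
  assumes "w \<in> carrier G" "a \<in> carrier G" "C \<subseteq> carrier G"
  shows "coset_action G w (a <# C) = (w \<otimes> a) <# C"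
proof -
  have image: "x <# C = (\<lambda>c. x \<otimes> c) ` C" for x
    by (auto simp: l_coset_def)
  show ?thesis
    unfolding coset_action_def image image_image
    by (rule image_cong) (use assms in \<open>auto simp: m_assoc\<close>)
qed

end

section \<open>The ordered set of cosets and its lift\<close>

context preordered_group
begin

definition cosets :: "'a set set" where
  "cosets = (\<lambda>a. a <# C) ` carrier G"

lemma core_carrier: "C \<subseteq> carrier G"
  by (auto simp: core_iff)

text \<open>Right multiplication by an element of \<open>C\<close> stays within an equivalence class
  of \<open>R\<close>, so the choice of representatives does not matter.\<close>

lemma coset_less_iff:
  assumes "a \<in> carrier G" "b \<in> carrier G"
  shows "coset_less R (a <# C) (b <# C) \<longleftrightarrow> (b, a) \<notin> R"
proof -
  have eq: "(x, x \<otimes> c) \<in> R \<and> (x \<otimes> c, x) \<in> R" if "x \<in> carrier G" "c \<in> C" for x c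
    using R_mult[OF that(1), of \<one> c] R_mult[OF that(1), of c \<one>] that by (auto simp: core_iff)
  have "(b \<otimes> d, a \<otimes> c) \<in> R \<longleftrightarrow> (b, a) \<in> R" if "c \<in> C" "d \<in> C" for c d
  proof -
    note ac = eq[OF assms(1) that(1)] and bd = eq[OF assms(2) that(2)]
    show ?thesis
      using R_trans[OF R_trans[OF conjunct1[OF bd], of "a \<otimes> c"] conjunct2[OF ac]]
        R_trans[OF R_trans[OF conjunct2[OF bd], of a] conjunct1[OF ac]] by blast
  qed
  moreover have "\<one> \<in> C" by (simp add: core_iff R_refl)
  ultimately show ?thesis unfolding coset_less_def l_coset_def by blast
qed

lemma coset_eq:
  assumes "a \<in> carrier G" "b \<in> carrier G" "(a, b) \<in> R" "(b, a) \<in> R"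
  shows "a <# C = b <# C"
proof -
  have *: "a <# C \<subseteq> b <# C" if ab: "a \<in> carrier G" "b \<in> carrier G" "(a, b) \<in> R" "(b, a) \<in> R" for a b
  proof
    fix x assume "x \<in> a <# C"
    then obtain c where c: "c \<in> C" "x = a \<otimes> c" by (auto simp: l_coset_def)
    have cc: "c \<in> carrier G" using c core_carrier by blast
    have "(\<one>, c) \<in> R" "(c, \<one>) \<in> R" using c by (simp_all add: core_iff)
    from this[THEN R_mult[OF ab(1)]] have "(a, x) \<in> R" "(x, a) \<in> R" using c ab by simp_all
    then have "(b, x) \<in> R" "(x, b) \<in> R"
      using R_trans[OF ab(4), of x] R_trans[OF _ ab(3), of x] by simp_all
    then have "inv b \<otimes> x \<in> C" using inv_core_iff[of b x] ab cc c by simp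
    then have "b \<otimes> (inv b \<otimes> x) \<in> b <# C" by (auto simp: l_coset_def)
    moreover have "b \<otimes> (inv b \<otimes> x) = x" using ab cc c by (simp add: m_assoc[symmetric])
    ultimately show "x \<in> b <# C" by simp
  qed
  show ?thesis using *[OF assms] *[OF assms(2,1,4,3)] by blast
qed

lemma strict_linear_on_cosets: "strict_linear_on cosets (coset_less R)"
proof -
  have "\<not> coset_less R A A" if "A \<in> cosets" for A
    using that by (auto simp: cosets_def coset_less_iff R_refl)
  moreover have "coset_less R A D"
    if ABD: "A \<in> cosets" "B \<in> cosets" "D \<in> cosets" "coset_less R A B" "coset_less R B D" for A B D
  proof -
    obtain a b d where abd: "a \<in> carrier G" "b \<in> carrier G" "d \<in> carrier G"
      and eqs: "A = a <# C" "B = b <# C" "D = d <# C"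
      using ABD(1-3) by (auto simp: cosets_def)
    have "(b, a) \<notin> R" "(d, b) \<notin> R" using ABD(4,5) abd by (simp_all add: eqs coset_less_iff)
    then have "(d, a) \<notin> R" using R_total[of a b] R_trans[of d a b] abd by blast
    then show ?thesis using abd by (simp add: eqs coset_less_iff)
  qed
  moreover have "A = B \<or> coset_less R A B \<or> coset_less R B A" if AB: "A \<in> cosets" "B \<in> cosets" for A B
  proof -
    obtain a b where ab: "a \<in> carrier G" "b \<in> carrier G" and eqs: "A = a <# C" "B = b <# C"
      using AB by (auto simp: cosets_def)
    then show ?thesis using coset_eq[OF ab] by (auto simp: coset_less_iff)
  qed
  ultimately show ?thesis unfolding strict_linear_on_def by (intro conjI ballI impI)
qed

lemma coset_action_order_auts:
  assumes w: "w \<in> carrier G"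
  shows "coset_action G w \<in> order_auts cosets (coset_less R)"
proof -
  have closed: "coset_action G u A \<in> cosets" if "u \<in> carrier G" "A \<in> cosets" for u A
    using that core_carrier by (auto simp: cosets_def coset_action_l_coset)
  have mono: "coset_less R (coset_action G u A) (coset_action G u B)"
    if "u \<in> carrier G" "A \<in> cosets" "B \<in> cosets" "coset_less R A B" for u A B
    using that core_carrier by (auto simp: cosets_def coset_action_l_coset coset_less_iff R_mult_iff)
  show ?thesis
    by (rule order_autsI[of "coset_action G (inv w)"])
      (use w closed mono coset_action_inv[OF w] in auto)
qed

text \<open>Two layers of functions, as \<open>push_up_aut\<close> requires: the inner one supplies
  the shifts, the outer one the functions that are shifted.\<close>

definition lifted_points :: "(('a set \<Rightarrow> int) \<Rightarrow> int) set" where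
  "lifted_points = fin_supp_funs (fin_supp_funs cosets)"

definition lifted_less :: "(('a set \<Rightarrow> int) \<Rightarrow> int) \<Rightarrow> (('a set \<Rightarrow> int) \<Rightarrow> int) \<Rightarrow> bool" where
  "lifted_less = lex_less (fin_supp_funs cosets) (lex_less cosets (coset_less R))"

definition lifted_action :: "'a \<Rightarrow> (('a set \<Rightarrow> int) \<Rightarrow> int) \<Rightarrow> (('a set \<Rightarrow> int) \<Rightarrow> int)" where
  "lifted_action w = lift_aut (lift_aut (coset_action G w))"

definition lifted_coset :: "'a set \<Rightarrow> (('a set \<Rightarrow> int) \<Rightarrow> int)" where
  "lifted_coset A = basis_fun (basis_fun A)"

lemma lifted_action_lifted_coset:
  assumes "w \<in> carrier G"
  shows "lifted_action w (lifted_coset A) = lifted_coset (coset_action G w A)"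
proof -
  have "bij (coset_action G w)" "bij (lift_aut (coset_action G w))"
    using coset_action_order_auts[OF assms] lift_aut_order_auts[OF coset_action_order_auts[OF assms]]
    by (simp_all add: order_auts_def)
  then show ?thesis by (simp add: lifted_action_def lifted_coset_def lift_aut_basis_fun)
qed

text \<open>The double basis embedding is equivariant and order preserving, so the orbit of the
  lifted coset \<open>C\<close> copies the ordered set of cosets.\<close>

lemma order_action_lifted:
  "order_action G R C lifted_points lifted_less lifted_action (lifted_coset C)"
proof
  note lin = strict_linear_on_cosets
  show "strict_linear_on lifted_points lifted_less"
    unfolding lifted_points_def lifted_less_def by (intro strict_linear_on_lex_less lin)
  have bij: "bij (coset_action G w)" "bij (lift_aut (coset_action G w))" if "w \<in> carrier G" for w
    using coset_action_order_auts[OF that] lift_aut_order_auts[OF coset_action_order_auts[OF that]]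
    by (simp_all add: order_auts_def)
  have "lifted_action w \<in> order_auts lifted_points lifted_less" if "w \<in> carrier G" for w
    unfolding lifted_action_def lifted_points_def lifted_less_def
    by (intro lift_aut_order_auts coset_action_order_auts that)
  moreover have "lifted_action (u \<otimes> w) = lifted_action u \<circ> lifted_action w"
    if "u \<in> carrier G" "w \<in> carrier G" for u w
    using that bij[OF that(1)] bij[OF that(2)]
    by (simp add: lifted_action_def coset_action_mult lift_aut_comp)
  ultimately show "lifted_action \<in> hom G (perm_group (order_auts lifted_points lifted_less))"
    by (auto simp: hom_def)
  have one_coset: "\<one> <# C = C" proof -
    have "(\<lambda>c. \<one> \<otimes> c) ` C = (\<lambda>c. c) ` C" using core_carrier by (intro image_cong) auto
    then show ?thesis by (auto simp: l_coset_def)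
  qed
  have in_cosets: "a <# C \<in> cosets" if "a \<in> carrier G" for a using that by (auto simp: cosets_def)
  have "C \<in> cosets" using in_cosets[OF one_closed] one_coset by simp
  then show "lifted_coset C \<in> lifted_points"
    by (simp add: lifted_coset_def lifted_points_def basis_fun_fin_supp_funs)
  have orbit: "lifted_action a (lifted_coset C) = lifted_coset (a <# C)" if "a \<in> carrier G" for a
    using coset_action_l_coset[OF that one_closed core_carrier] lifted_action_lifted_coset[OF that] that
    by (simp add: one_coset)
  show "lifted_less (lifted_action a (lifted_coset C)) (lifted_action b (lifted_coset C)) \<longleftrightarrow> (b, a) \<notin> R"
    if "a \<in> carrier G" "b \<in> carrier G" for a b
    using that in_cosets[OF that(1)] in_cosets[OF that(2)]
      lex_less_basis_fun[OF lin] lex_less_basis_fun[OF strict_linear_on_lex_less[OF lin]]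
    unfolding orbit[OF that(1)] orbit[OF that(2)]
    by (simp add: lifted_coset_def lifted_less_def basis_fun_fin_supp_funs coset_less_iff)
qed

lemma lifted_push:
  assumes "p \<in> lifted_points" "c \<in> lifted_points" "d \<in> lifted_points" "lifted_less p c"
  shows "\<exists>\<phi>\<in>order_auts lifted_points lifted_less.
    (\<forall>y. \<not> lifted_less p y \<longrightarrow> \<phi> y = y) \<and> lifted_less d (\<phi> c)"
proof -
  have "\<one> <# C \<in> cosets" by (auto simp: cosets_def)
  from push_up_aut[OF strict_linear_on_cosets this, folded lifted_points_def lifted_less_def, OF assms]
  show ?thesis by metis
qed

text \<open>Singletons need not be cosets; they only serve as points moved by every non-trivial
  element.\<close>

lemma lifted_free:
  assumes h: "h \<in> carrier G" "h \<noteq> \<one>"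
  shows "infinite {z. lifted_action h z \<noteq> z}"
proof -
  have "lifted_action h (lifted_coset {w}) \<noteq> lifted_coset {w}" if "w \<in> carrier G" for w
    unfolding lifted_action_lifted_coset[OF h(1)]
    using h that by (simp add: coset_action_def lifted_coset_def)
  then have "(\<lambda>w. lifted_coset {w}) ` carrier G \<subseteq> {z. lifted_action h z \<noteq> z}"
    by auto
  moreover have "inj_on (\<lambda>w. lifted_coset {w}) (carrier G)"
    by (rule inj_onI) (simp add: lifted_coset_def)
  ultimately show ?thesis
    using infinite_carrier finite_imageD[of "\<lambda>w. lifted_coset {w}"] finite_subset by blast
qed

section \<open>Perturbing a left-preorder\<close>

lemma finite_suffix_closed_words:
  assumes "finite E" "\<And>e. e \<in> E \<Longrightarrow> \<exists>l. set l \<subseteq> A \<and> word_value G l = e"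
  obtains W where "finite W" "suffix_closed_words A W" "E \<subseteq> word_value G ` W"
proof -
  obtain L where L: "\<And>e. e \<in> E \<Longrightarrow> set (L e) \<subseteq> A \<and> word_value G (L e) = e"
    using assms(2) by metis
  \<comment> \<open>All suffixes of the chosen words; the bound includes the length itself, so the
    empty suffix belongs too.\<close>
  define W where "W = (\<Union>e\<in>E. (\<lambda>n. drop n (L e)) ` {..length (L e)})"
  have "finite W" using assms(1) by (simp add: W_def)
  moreover have "suffix_closed_words A W"
    unfolding suffix_closed_words_def
  proof (intro allI impI)
    fix x l assume "x # l \<in> W"
    then obtain e n where e: "e \<in> E" "drop n (L e) = x # l" by (auto simp: W_def)
    then have n: "n < length (L e)" by (metis drop_all list.distinct(1) not_less)
    have "x \<in> set (L e)" using e(2) by (metis in_set_dropD list.set_intros(1))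
    moreover have "l = drop (Suc n) (L e)" using e(2) by (metis drop_Suc list.sel(3) tl_drop)
    then have "l \<in> W"
      unfolding W_def using e(1) n by (intro UN_I[of e] image_eqI[of _ _ "Suc n"]) auto
    ultimately show "x \<in> A \<and> l \<in> W" using L[OF e(1)] by blast
  qed
  moreover have "E \<subseteq> word_value G ` W"
  proof
    fix e assume e: "e \<in> E"
    then have "L e \<in> W" by (auto simp: W_def intro!: bexI[of _ e] image_eqI[of _ _ 0])
    then show "e \<in> word_value G ` W" using L[OF e] by (metis image_eqI)
  qed
  ultimately show thesis by (rule that)
qed

text \<open>If no generator raised \<open>v\<close>, no word would, by induction. But the word for
  \<open>u \<otimes> inv v\<close> takes \<open>v\<close> to \<open>u\<close>, which can be chosen
  strictly above.\<close>

lemma generator_above: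
  assumes A: "A \<subseteq> carrier G" and gen: "\<And>w. w \<in> carrier G \<Longrightarrow> \<exists>l. set l \<subseteq> A \<and> word_value G l = w"
    and v: "v \<in> carrier G"
  obtains x where "x \<in> A" "(x \<otimes> v, v) \<notin> R"
proof (rule ccontr)
  assume "\<not> thesis"
  then have below: "(x \<otimes> v, v) \<in> R" if "x \<in> A" for x using that \<open>\<And>x. x \<in> A \<Longrightarrow> (x \<otimes> v, v) \<notin> R \<Longrightarrow> thesis\<close> by blast
  have word: "word_value G l \<in> carrier G \<and> (word_value G l \<otimes> v, v) \<in> R" if "set l \<subseteq> A" for l
    using that
  proof (induction l)
    case Nil
    then show ?case using v by (simp add: R_refl)
  next
    case (Cons x l)
    then have x: "x \<in> A" "x \<in> carrier G" and l: "word_value G l \<in> carrier G" "(word_value G l \<otimes> v, v) \<in> R"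
      using A by auto
    have "(x \<otimes> (word_value G l \<otimes> v), v) \<in> R"
      using R_trans[OF R_mult[OF x(2) l(2)] below[OF x(1)]] .
    then show ?case using x l v by (simp add: m_assoc)
  qed
  obtain u where u: "u \<in> carrier G" "(u, v) \<notin> R" using no_greatest[OF v] .
  obtain l where "set l \<subseteq> A" "word_value G l = u \<otimes> inv v" using gen[of "u \<otimes> inv v"] u v by auto
  then show False using word[of l] u v by (simp add: m_assoc)
qed

lemma perturb_preorder:
  assumes A: "subgroup A G" "A \<noteq> {\<one>}" and B: "subgroup B G" "B \<noteq> {\<one>}"
    and gen: "\<And>w. w \<in> carrier G \<Longrightarrow> \<exists>l. set l \<subseteq> A \<union> B \<and> word_value G l = w"
    and tw: "twistable TYPE(('a set \<Rightarrow> int) \<Rightarrow> int) G A B" "twistable TYPE(('a set \<Rightarrow> int) \<Rightarrow> int) G B A"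
    and C: "finitely_generated_subgroup G C" and I: "finite I" "I \<subseteq> carrier G"
  obtains R' where "left_preorder_rel G C R'" "R' \<noteq> R"
    "\<And>w. w \<in> I \<Longrightarrow> (\<one>, w) \<in> R' \<longleftrightarrow> (\<one>, w) \<in> R" "\<And>w. w \<in> I \<Longrightarrow> (w, \<one>) \<in> R' \<longleftrightarrow> (w, \<one>) \<in> R"
proof -
  interpret order_action G R C lifted_points lifted_less lifted_action "lifted_coset C"
    by (rule order_action_lifted)
  obtain T where T: "finite T" "T \<subseteq> carrier G" "C = generate G T"
    using C unfolding finitely_generated_subgroup_def by blast
  \<comment> \<open>Finite generation of \<open>C\<close> makes the set of prescribed elements
    finite. The unit ensures that a largest value exists even if \<open>T\<close> and
    \<open>I\<close> are empty.\<close>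
  have "finite (insert \<one> (T \<union> I))" "\<And>e. e \<in> insert \<one> (T \<union> I) \<Longrightarrow> \<exists>l. set l \<subseteq> A \<union> B \<and> word_value G l = e"
    using T I gen by auto
  then obtain W where W: "finite W" "suffix_closed_words (A \<union> B) W" "insert \<one> (T \<union> I) \<subseteq> word_value G ` W"
    using finite_suffix_closed_words by metis
  have ABc: "A \<subseteq> carrier G" "B \<subseteq> carrier G" "A \<union> B \<subseteq> carrier G"
    using subgroup.subset A B by blast+
  have Wc: "word_value G ` W \<subseteq> carrier G" using word_value_closed[OF W(2) ABc(3)] by blast
  have TI: "T \<subseteq> word_value G ` W" "I \<subseteq> word_value G ` W" "word_value G ` W \<noteq> {}" using W(3) by auto
  obtain v where v: "v \<in> word_value G ` W" "\<And>e. e \<in> word_value G ` W \<Longrightarrow> (e, v) \<in> R"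
    using finite_greatest[OF finite_imageI[OF W(1)] TI(3) Wc] by metis
  have vc: "v \<in> carrier G" using v Wc by blast
  obtain a b where ab: "a \<in> A" "a \<noteq> \<one>" "b \<in> B" "b \<noteq> \<one>"
    using A B subgroup.one_closed by blast
  obtain g where g: "g \<in> A \<union> B" "(g \<otimes> v, v) \<notin> R" using generator_above[OF ABc(3) gen vc] .
  have W': "suffix_closed_words (B \<union> A) W" using W(2) by (simp add: Un_commute)
  have "\<exists>R'. left_preorder_rel G C R' \<and> R' \<noteq> R \<and>
      (\<forall>w\<in>I. ((\<one>, w) \<in> R' \<longleftrightarrow> (\<one>, w) \<in> R) \<and> ((w, \<one>) \<in> R' \<longleftrightarrow> (w, \<one>) \<in> R))"
  \<comment> \<open>The factor containing \<open>g\<close> keeps its action; a non-trivial element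
    of the other one provides \<open>h\<close>.\<close>
  proof (cases "g \<in> A")
    case True
    show ?thesis
      using exists_other_preorder[OF ABc(1,2) subgroup.m_inv_closed[OF B(1)] tw(1) lifted_push lifted_free
          W(1,2) T(3) TI(1,2) v True g(2) ab(3,4)] by blast
  next
    case False
    then have gB: "g \<in> B" using g(1) by blast
    show ?thesis
      using exists_other_preorder[OF ABc(2,1) subgroup.m_inv_closed[OF A(1)] tw(2) lifted_push lifted_free
          W(1) W' T(3) TI(1,2) v gB g(2) ab(1,2)] by blast
  qed
  then show thesis using that by blast
qed

end

section \<open>Application to free products\<close>

text \<open>A basic open set of the product restricts only finitely many coordinates; these form
  \<open>I\<close>. Injectivity of \<open>preorder_map\<close> turns equality of maps into equality
  of relations.\<close>

lemma isolated_elementE: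
  assumes "group G" and iso: "isolated_element (PO_topology G C) \<phi>"
  obtains R I where "left_preorder_rel G C R" "finite I" "I \<subseteq> carrier G"
    "\<And>R'. left_preorder_rel G C R' \<Longrightarrow>
       (\<And>w. w \<in> I \<Longrightarrow> preorder_map G R' w = preorder_map G R w) \<Longrightarrow> R' = R"
proof -
  let ?X = "product_topology (\<lambda>_. discrete_topology {1, -1, 0 :: int}) (carrier G)"
  have "\<phi> \<in> PO G C" "openin (subtopology ?X (PO G C)) {\<phi>}"
    using iso topspace_PO_topology[of G C] by (simp_all add: isolated_element_def PO_topology_def)
  then obtain R U where R: "left_preorder_rel G C R" "\<phi> = preorder_map G R"
    and U: "openin ?X U" "{\<phi>} = U \<inter> PO G C"
    unfolding PO_def openin_subtopology by blast
  have "\<phi> \<in> U" using U(2) by blast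
  then obtain V where V: "finite {i \<in> carrier G. V i \<noteq> {1, -1, 0}}" "\<phi> \<in> Pi\<^sub>E (carrier G) V" "Pi\<^sub>E (carrier G) V \<subseteq> U"
    using U(1) unfolding openin_product_topology_alt by auto
  define I where "I = {i \<in> carrier G. V i \<noteq> {1, -1, 0}}"
  have "R' = R" if R': "left_preorder_rel G C R'" and
    eq: "\<And>w. w \<in> I \<Longrightarrow> preorder_map G R' w = preorder_map G R w" for R'
  proof -
    have "preorder_map G R' \<in> Pi\<^sub>E (carrier G) V"
    proof (rule PiE_I)
      fix w assume w: "w \<in> carrier G"
      show "preorder_map G R' w \<in> V w"
      proof (cases "w \<in> I")
        case True
        then show ?thesis using eq[OF True] V(2) w R(2) by (auto simp: PiE_iff)
      next
        case False
        then have "V w = {1, -1, 0}" using w by (simp add: I_def)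
        then show ?thesis using w by (simp add: preorder_map_def)
      qed
    qed (simp add: preorder_map_def)
    moreover have "preorder_map G R' \<in> PO G C" using R' by (auto simp: PO_def)
    ultimately have "preorder_map G R' = preorder_map G R" using V(3) U(2) R(2) by blast
    then show "R' = R"
      using inj_on_preorder_map[OF assms(1)] R' R(1)
      by (auto simp: left_preorder_rel_def dest: inj_onD)
  qed
  then show thesis using that[of R I] R(1) V(1) by (auto simp: I_def)
qed

lemma preorder_map_cong:
  assumes "left_preorder_rel G C R" "left_preorder_rel G C R'" "w \<in> carrier G" "inv\<^bsub>G\<^esub> w \<in> carrier G"
    and "(\<one>\<^bsub>G\<^esub>, w) \<in> R' \<longleftrightarrow> (\<one>\<^bsub>G\<^esub>, w) \<in> R" "(\<one>\<^bsub>G\<^esub>, inv\<^bsub>G\<^esub> w) \<in> R' \<longleftrightarrow> (\<one>\<^bsub>G\<^esub>, inv\<^bsub>G\<^esub> w) \<in> R"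
  shows "preorder_map G R' w = preorder_map G R w"
proof -
  have "preorder_core G R' = preorder_core G R" using assms(1,2) by (simp add: left_preorder_rel_def)
  then show ?thesis using assms by (simp add: preorder_map_def positive_cone_def)
qed

section \<open>Conjugating and generating by the factors of a free product\<close>

context
  fixes G :: "('a, 'm) monoid_scheme" and H :: "('b, 'n) monoid_scheme"
  assumes G: "group G" and H: "group H"
begin

text \<open>Each restriction of \<open>F\<close> to a factor is followed by an inner automorphism of
  \<open>K\<close>, and the universal property joins the results.\<close>

lemma free_product_twist:
  fixes K :: "('c, 'k) monoid_scheme"
  assumes K: "group K" and F: "F \<in> hom (free_product G H) K" and \<phi>: "\<phi> \<in> carrier K" and \<chi>: "\<chi> \<in> carrier K"
  shows "\<exists>F'\<in>hom (free_product G H) K.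
    (\<forall>a\<in>free_product_Inl G ` carrier G. F' a = \<phi> \<otimes>\<^bsub>K\<^esub> F a \<otimes>\<^bsub>K\<^esub> inv\<^bsub>K\<^esub> \<phi>) \<and>
    (\<forall>b\<in>free_product_Inr H ` carrier H. F' b = \<chi> \<otimes>\<^bsub>K\<^esub> F b \<otimes>\<^bsub>K\<^esub> inv\<^bsub>K\<^esub> \<chi>)"
proof -
  interpret K: group K by (rule K)
  have conj: "(\<lambda>x. \<tau> \<otimes>\<^bsub>K\<^esub> f x \<otimes>\<^bsub>K\<^esub> inv\<^bsub>K\<^esub> \<tau>) \<in> hom L K"
    if f: "f \<in> hom L K" and \<tau>: "\<tau> \<in> carrier K" for f \<tau> and L :: "('d, 'l) monoid_scheme"
  proof (rule homI)
    show "\<tau> \<otimes>\<^bsub>K\<^esub> f x \<otimes>\<^bsub>K\<^esub> inv\<^bsub>K\<^esub> \<tau> \<in> carrier K" if "x \<in> carrier L" for x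
      using f \<tau> that by (auto simp: hom_def)
    show "\<tau> \<otimes>\<^bsub>K\<^esub> f (x \<otimes>\<^bsub>L\<^esub> y) \<otimes>\<^bsub>K\<^esub> inv\<^bsub>K\<^esub> \<tau> =
        \<tau> \<otimes>\<^bsub>K\<^esub> f x \<otimes>\<^bsub>K\<^esub> inv\<^bsub>K\<^esub> \<tau> \<otimes>\<^bsub>K\<^esub> (\<tau> \<otimes>\<^bsub>K\<^esub> f y \<otimes>\<^bsub>K\<^esub> inv\<^bsub>K\<^esub> \<tau>)"
      if "x \<in> carrier L" "y \<in> carrier L" for x y
    proof -
      have xy: "f x \<in> carrier K" "f y \<in> carrier K" using f that by (auto simp: hom_def)
      have "inv\<^bsub>K\<^esub> \<tau> \<otimes>\<^bsub>K\<^esub> (\<tau> \<otimes>\<^bsub>K\<^esub> z) = z" if "z \<in> carrier K" for z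
        using \<tau> that by (simp add: K.m_assoc[symmetric])
      then show ?thesis using f \<tau> that xy by (simp add: hom_mult[OF f] K.m_assoc)
    qed
  qed
  have "F \<circ> free_product_Inl G \<in> hom G K" "F \<circ> free_product_Inr H \<in> hom H K"
    using hom_compose[OF free_product_Inl_hom[OF G H] F] hom_compose[OF free_product_Inr_hom[OF G H] F] by auto
  from free_product_universal[OF G H K conj[OF this(1) \<phi>] conj[OF this(2) \<chi>]]
  show ?thesis by simp
qed

text \<open>Both cases come from \<open>free_product_twist\<close> with \<open>id\<close> as one
  conjugator; a compositional inverse within \<open>S\<close> is the group inverse there.\<close>

lemma twistable_free_product:
  shows "twistable TYPE('o) (free_product G H) (free_product_Inl G ` carrier G) (free_product_Inr H ` carrier H)"
    and "twistable TYPE('o) (free_product G H) (free_product_Inr H ` carrier H) (free_product_Inl G ` carrier G)"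
proof -
  have \<psi>: "inv\<^bsub>perm_group S\<^esub> \<phi> = \<psi>"
    if "group (perm_group S)" "\<phi> \<in> S" "\<psi> \<in> S" "\<phi> \<circ> \<psi> = id" "\<psi> \<circ> \<phi> = id" for S and \<phi> \<psi> :: "'o \<Rightarrow> 'o"
    using group.inv_equality[OF that(1), of \<psi> \<phi>] that by simp
  have one: "inv\<^bsub>perm_group S\<^esub> id = id" "id \<in> S" if "group (perm_group S)" for S :: "('o \<Rightarrow> 'o) set"
    using group.is_monoid[OF that, THEN monoid.inv_one] group.is_monoid[OF that, THEN monoid.one_closed] by simp_all
  show "twistable TYPE('o) (free_product G H) (free_product_Inl G ` carrier G) (free_product_Inr H ` carrier H)"
    unfolding twistable_def
  proof (intro allI ballI impI)
    fix S :: "('o \<Rightarrow> 'o) set" and F \<phi> \<psi>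
    assume a: "\<phi> \<in> S" "\<psi> \<in> S" "group (perm_group S)" "F \<in> hom (free_product G H) (perm_group S)"
      "\<phi> \<circ> \<psi> = id" "\<psi> \<circ> \<phi> = id"
    show "\<exists>F'\<in>hom (free_product G H) (perm_group S). (\<forall>a\<in>free_product_Inl G ` carrier G. F' a = F a) \<and>
        (\<forall>b\<in>free_product_Inr H ` carrier H. F' b = \<phi> \<circ> F b \<circ> \<psi>)"
      using free_product_twist[OF a(3,4), of id \<phi>] a(1) one[OF a(3)] \<psi>[OF a(3,1,2,5,6)] by simp
  qed
  show "twistable TYPE('o) (free_product G H) (free_product_Inr H ` carrier H) (free_product_Inl G ` carrier G)"
    unfolding twistable_def
  proof (intro allI ballI impI)
    fix S :: "('o \<Rightarrow> 'o) set" and F \<phi> \<psi>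
    assume a: "\<phi> \<in> S" "\<psi> \<in> S" "group (perm_group S)" "F \<in> hom (free_product G H) (perm_group S)"
      "\<phi> \<circ> \<psi> = id" "\<psi> \<circ> \<phi> = id"
    show "\<exists>F'\<in>hom (free_product G H) (perm_group S). (\<forall>a\<in>free_product_Inr H ` carrier H. F' a = F a) \<and>
        (\<forall>b\<in>free_product_Inl G ` carrier G. F' b = \<phi> \<circ> F b \<circ> \<psi>)"
      using free_product_twist[OF a(3,4), of \<phi> id] a(1) one[OF a(3)] \<psi>[OF a(3,1,2,5,6)] by (simp add: conj_commute)
  qed
qed

lemma free_product_generated:
  assumes "w \<in> carrier (free_product G H)"
  shows "\<exists>l. set l \<subseteq> free_product_Inl G ` carrier G \<union> free_product_Inr H ` carrier H \<and>
    word_value (free_product G H) l = w"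
proof (intro exI conjI)
  have letters: "set w \<subseteq> free_product_letters G H" using assms by (simp add: reduced_words_def)
  show "set (map (\<lambda>x. [x]) w) \<subseteq> free_product_Inl G ` carrier G \<union> free_product_Inr H ` carrier H"
  proof
    fix l assume "l \<in> set (map (\<lambda>x. [x]) w)"
    then obtain x where x: "x \<in> free_product_letters G H" "l = [x]" using letters by auto
    show "l \<in> free_product_Inl G ` carrier G \<union> free_product_Inr H ` carrier H"
    proof (cases x)
      case (Inl g)
      then have "l = free_product_Inl G g" "g \<in> carrier G"
        using x by (auto simp: free_product_Inl_def[OF G H])
      then show ?thesis by blast
    next
      case (Inr h)
      then have "l = free_product_Inr H h" "h \<in> carrier H"
        using x by (auto simp: free_product_Inr_def[OF G H])
      then show ?thesis by blast
    qed
  qed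
  have "word_value (free_product G H) (map (\<lambda>x. [x]) w) = foldr (letter_mult G H) w []"
    by (induction w) simp_all
  then show "word_value (free_product G H) (map (\<lambda>x. [x]) w) = w"
    using foldr_letter_mult_Nil[OF G H] assms by simp
qed

lemma subgroup_free_product_factors:
  shows "subgroup (free_product_Inl G ` carrier G) (free_product G H)"
    and "subgroup (free_product_Inr H ` carrier H) (free_product G H)"
proof -
  interpret l: group_hom G "free_product G H" "free_product_Inl G"
    using G group_free_product[OF G H] free_product_Inl_hom[OF G H]
    by (simp add: group_hom_def group_hom_axioms_def)
  interpret r: group_hom H "free_product G H" "free_product_Inr H"
    using H group_free_product[OF G H] free_product_Inr_hom[OF G H]
    by (simp add: group_hom_def group_hom_axioms_def)
  show "subgroup (free_product_Inl G ` carrier G) (free_product G H)"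
    "subgroup (free_product_Inr H ` carrier H) (free_product G H)"
    by (rule l.img_is_subgroup r.img_is_subgroup)+
qed

end

theorem theorem1p5:
  fixes G :: "('a, 'm) monoid_scheme" and H :: "('b, 'n) monoid_scheme"
    and C :: "('a + 'b) list set"
  assumes "group G" and "group H"
    and "carrier G \<noteq> {\<one>\<^bsub>G\<^esub>}" and "carrier H \<noteq> {\<one>\<^bsub>H\<^esub>}"
    and "left_relatively_convex (free_product G H) C"
    and "finitely_generated_subgroup (free_product G H) C"
  shows "\<not> (\<exists>\<phi>. isolated_element (PO_topology (free_product G H) C) \<phi>)"
proof
  let ?P = "free_product G H"
  let ?A = "free_product_Inl G ` carrier G" and ?B = "free_product_Inr H ` carrier H"
  interpret P: group ?P by (rule group_free_product[OF assms(1,2)])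
  assume "\<exists>\<phi>. isolated_element (PO_topology ?P C) \<phi>"
  then obtain R I where R: "left_preorder_rel ?P C R" and I: "finite I" "I \<subseteq> carrier ?P"
    and unique: "\<And>R'. left_preorder_rel ?P C R' \<Longrightarrow>
       (\<And>w. w \<in> I \<Longrightarrow> preorder_map ?P R' w = preorder_map ?P R w) \<Longrightarrow> R' = R"
    using isolated_elementE[OF P.is_group] by metis
  interpret preordered_group ?P R C
    using R by unfold_locales
  have "\<exists>g\<in>carrier G. g \<noteq> \<one>\<^bsub>G\<^esub>" "\<exists>h\<in>carrier H. h \<noteq> \<one>\<^bsub>H\<^esub>"
    using assms(3,4) group.is_monoid[OF assms(1), THEN monoid.one_closed]
      group.is_monoid[OF assms(2), THEN monoid.one_closed] by blast+
  then have nontrivial: "?A \<noteq> {\<one>\<^bsub>?P\<^esub>}" "?B \<noteq> {\<one>\<^bsub>?P\<^esub>}"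
    by (fastforce simp: free_product_Inl_def[OF assms(1,2)] free_product_Inr_def[OF assms(1,2)])+
  \<comment> \<open>The sign at \<open>w\<close> also depends on the comparison of the unit with the
    inverse of \<open>w\<close>.\<close>
  define J where "J = I \<union> (\<lambda>w. inv\<^bsub>?P\<^esub> w) ` I"
  have J: "finite J" "J \<subseteq> carrier ?P" using I by (auto simp: J_def simp del: free_product_simps)
  obtain R' where R': "left_preorder_rel ?P C R'" "R' \<noteq> R"
    "\<And>w. w \<in> J \<Longrightarrow> (\<one>\<^bsub>?P\<^esub>, w) \<in> R' \<longleftrightarrow> (\<one>\<^bsub>?P\<^esub>, w) \<in> R"
    using perturb_preorder[OF subgroup_free_product_factors(1)[OF assms(1,2)] nontrivial(1)
        subgroup_free_product_factors(2)[OF assms(1,2)] nontrivial(2)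
        free_product_generated[OF assms(1,2)] twistable_free_product[OF assms(1,2)] assms(6) J] by metis
  have "preorder_map ?P R' w = preorder_map ?P R w" if "w \<in> I" for w
    using preorder_map_cong[OF R R'(1), of w] R'(3)[of w] R'(3)[of "inv\<^bsub>?P\<^esub> w"] that I(2)
    by (auto simp: J_def simp del: free_product_simps)
  then have "R' = R" by (rule unique[OF R'(1)])
  with R'(2) show False ..
qed

end
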